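(* Let $\mathcal B$ be a Krull–Schmidt exact category with enough projectives and enough injectives, and let $(\mathcal S,\mathcal T),(\mathcal U,\mathcal V)$ be a twin cotorsion pair on $\mathcal B$. Then its heart $\underline{\mathcal H}=\mathcal H/\mathcal W$ is a preabelian category.
   Context: Exact category is meant in the sense of Quillen (the class of short exact sequences is closed under isomorphisms, direct sums and direct summands); $X\rightarrowtail Y\twoheadrightarrow Z$ denotes a short exact sequence of the exact structure. For subcategories $\mathcal C,\mathcal D$, $\mathrm{Ext}^1_{\mathcal B}(\mathcal C,\mathcal D)=0$ means $\mathrm{Ext}^1_{\mathcal B}(C,D)=0$ for all $C\in\mathcal C$, $D\in\mathcal D$. Cotorsion pair: a pair $(\mathcal U,\mathcal V)$ of full additive subcategories of $\mathcal B$, closed under direct summands, such that $\mathrm{Ext}^1_{\mathcal B}(\mathcal U,\mathcal V)=0$ and every $B\in\mathcal B$ admits short exact sequences $V_B\rightarrowtail U_B\twoheadrightarrow B$ and $B\rightarrowtail V^B\twoheadrightarrow U^B$ with $U_B,U^B\in\mathcal U$, $V_B,V^B\in\mathcal V$. Twin cotorsion pair: a pair of cotorsion pairs $(\mathcal S,\mathcal T),(\mathcal U,\mathcal V)$ with $\mathcal S\subseteq\mathcal U$. For a twin cotorsion pair put $\mathcal W=\mathcal T\cap\mathcal U$. $\mathcal B^+$ is the full subcategory of objects $B$ admitting a short exact sequence $V_B\rightarrowtail U_B\twoheadrightarrow B$ with $U_B\in\mathcal W$, $V_B\in\mathcal V$. $\mathcal B^-$ is the full subcategory of objects $B$ admitting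 a short exact sequence $B\rightarrowtail T^B\twoheadrightarrow S^B$ with $T^B\in\mathcal W$, $S^B\in\mathcal S$. Put $\mathcal H=\mathcal B^+\cap\mathcal B^-\supseteq\mathcal W$. The heart is the additive quotient category $\underline{\mathcal H}=\mathcal H/\mathcal W$ (morphisms modulo those factoring through an object of $\mathcal W$). Preabelian: an additive category in which every morphism has a kernel and a cokernel. *)

theory Defs
  imports "HOL-Algebra.Ring"
begin

section \<open>Categories with addable morphisms\<close>

text \<open>
  Objects and morphisms are carrier sets inside arbitrary types. Composition is in the usual
  order: \<open>g \<cdot> f\<close> is ``first \<open>f\<close>, then \<open>g\<close>''. The operations are only
  constrained on the carriers.
\<close>

record ('o, 'm) cat =
  Obj :: "'o set"
  Arr :: "'m set"
  Dom :: "'m \<Rightarrow> 'o"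
  Cod :: "'m \<Rightarrow> 'o"
  Idn :: "'o \<Rightarrow> 'm"
  Comp :: "'m \<Rightarrow> 'm \<Rightarrow> 'm" (infixl "\<cdot>\<index>" 70)
  Zero :: "'o \<Rightarrow> 'o \<Rightarrow> 'm"
  Add :: "'m \<Rightarrow> 'm \<Rightarrow> 'm" (infixl "\<boxplus>\<index>" 65)

definition Hom :: "('o, 'm) cat \<Rightarrow> 'o \<Rightarrow> 'o \<Rightarrow> 'm set" where
  "Hom C X Y = {f \<in> Arr C. Dom C f = X \<and> Cod C f = Y}"

text \<open>The additive group of morphisms, as a (multiplicatively written) HOL-Algebra group.\<close>

definition Hom_group :: "('o, 'm) cat \<Rightarrow> 'o \<Rightarrow> 'o \<Rightarrow> 'm monoid" where
  "Hom_group C X Y = \<lparr>carrier = Hom C X Y, mult = Add C, one = Zero C X Y\<rparr>"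

locale category =
  fixes C :: "('o, 'm) cat" (structure)
  assumes dom_obj: "f \<in> Arr C \<Longrightarrow> Dom C f \<in> Obj C"
    and cod_obj: "f \<in> Arr C \<Longrightarrow> Cod C f \<in> Obj C"
    and id_hom: "X \<in> Obj C \<Longrightarrow> Idn C X \<in> Hom C X X"
    and comp_hom: "\<lbrakk>f \<in> Hom C X Y; g \<in> Hom C Y Z\<rbrakk> \<Longrightarrow> g \<cdot> f \<in> Hom C X Z"
    and comp_id_left: "f \<in> Hom C X Y \<Longrightarrow> Idn C Y \<cdot> f = f"
    and comp_id_right: "f \<in> Hom C X Y \<Longrightarrow> f \<cdot> Idn C X = f"
    and comp_assoc: "\<lbrakk>f \<in> Hom C X Y; g \<in> Hom C Y Z; h \<in> Hom C Z Z'\<rbrakk>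
      \<Longrightarrow> (h \<cdot> g) \<cdot> f = h \<cdot> (g \<cdot> f)"

locale preadditive_category = category +
  assumes hom_group: "\<lbrakk>X \<in> Obj C; Y \<in> Obj C\<rbrakk> \<Longrightarrow> comm_group (Hom_group C X Y)"
    and comp_add_left: "\<lbrakk>f \<in> Hom C X Y; g \<in> Hom C Y Z; g' \<in> Hom C Y Z\<rbrakk>
      \<Longrightarrow> (g \<boxplus> g') \<cdot> f = g \<cdot> f \<boxplus> g' \<cdot> f"
    and comp_add_right: "\<lbrakk>f \<in> Hom C X Y; f' \<in> Hom C X Y; g \<in> Hom C Y Z\<rbrakk>
      \<Longrightarrow> g \<cdot> (f \<boxplus> f') = g \<cdot> f \<boxplus> g \<cdot> f'"

definition zero_object :: "('o, 'm) cat \<Rightarrow> 'o \<Rightarrow> bool" where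
  "zero_object C Z \<longleftrightarrow> Z \<in> Obj C \<and>
    (\<forall>X\<in>Obj C. (\<exists>!f. f \<in> Hom C X Z) \<and> (\<exists>!f. f \<in> Hom C Z X))"

text \<open>\<open>Z = X \<oplus> Y\<close> with injections \<open>i\<close>, \<open>j\<close> and projections \<open>p\<close>, \<open>q\<close>.\<close>

definition biproduct ::
  "('o, 'm) cat \<Rightarrow> 'o \<Rightarrow> 'o \<Rightarrow> 'o \<Rightarrow> 'm \<Rightarrow> 'm \<Rightarrow> 'm \<Rightarrow> 'm \<Rightarrow> bool" where
  "biproduct C X Y Z i j p q \<longleftrightarrow>
    X \<in> Obj C \<and> Y \<in> Obj C \<and> Z \<in> Obj C \<and>
    i \<in> Hom C X Z \<and> j \<in> Hom C Y Z \<and> p \<in> Hom C Z X \<and> q \<in> Hom C Z Y \<and>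
    p \<cdot>\<^bsub>C\<^esub> i = Idn C X \<and> q \<cdot>\<^bsub>C\<^esub> j = Idn C Y \<and>
    q \<cdot>\<^bsub>C\<^esub> i = Zero C X Y \<and> p \<cdot>\<^bsub>C\<^esub> j = Zero C Y X \<and>
    i \<cdot>\<^bsub>C\<^esub> p \<boxplus>\<^bsub>C\<^esub> j \<cdot>\<^bsub>C\<^esub> q = Idn C Z"

locale additive_category = preadditive_category +
  assumes ex_zero_object: "\<exists>Z. zero_object C Z"
    and ex_biproduct: "\<lbrakk>X \<in> Obj C; Y \<in> Obj C\<rbrakk> \<Longrightarrow> \<exists>Z i j p q. biproduct C X Y Z i j p q"

definition is_iso :: "('o, 'm) cat \<Rightarrow> 'm \<Rightarrow> bool" where
  "is_iso C f \<longleftrightarrow> f \<in> Arr C \<and> (\<exists>g \<in> Hom C (Cod C f) (Dom C f).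
    g \<cdot>\<^bsub>C\<^esub> f = Idn C (Dom C f) \<and> f \<cdot>\<^bsub>C\<^esub> g = Idn C (Cod C f))"


section \<open>Kernels, cokernels, preabelian categories\<close>

definition is_kernel :: "('o, 'm) cat \<Rightarrow> 'm \<Rightarrow> 'm \<Rightarrow> bool" where
  "is_kernel C k f \<longleftrightarrow> k \<in> Arr C \<and> f \<in> Arr C \<and> Cod C k = Dom C f \<and>
    f \<cdot>\<^bsub>C\<^esub> k = Zero C (Dom C k) (Cod C f) \<and>
    (\<forall>X\<in>Obj C. \<forall>h\<in>Hom C X (Dom C f). f \<cdot>\<^bsub>C\<^esub> h = Zero C X (Cod C f) \<longrightarrow>
      (\<exists>!u. u \<in> Hom C X (Dom C k) \<and> k \<cdot>\<^bsub>C\<^esub> u = h))"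

definition is_cokernel :: "('o, 'm) cat \<Rightarrow> 'm \<Rightarrow> 'm \<Rightarrow> bool" where
  "is_cokernel C c f \<longleftrightarrow> c \<in> Arr C \<and> f \<in> Arr C \<and> Dom C c = Cod C f \<and>
    c \<cdot>\<^bsub>C\<^esub> f = Zero C (Dom C f) (Cod C c) \<and>
    (\<forall>X\<in>Obj C. \<forall>h\<in>Hom C (Cod C f) X. h \<cdot>\<^bsub>C\<^esub> f = Zero C (Dom C f) X \<longrightarrow>
      (\<exists>!u. u \<in> Hom C (Cod C c) X \<and> u \<cdot>\<^bsub>C\<^esub> c = h))"

locale preabelian_category = additive_category +
  assumes ex_kernel: "f \<in> Arr C \<Longrightarrow> \<exists>k. is_kernel C k f"
    and ex_cokernel: "f \<in> Arr C \<Longrightarrow> \<exists>c. is_cokernel C c f"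


section \<open>Exact categories\<close>

text \<open>The square \<open>f' \<cdot> g = g' \<cdot> f\<close> is a pushout of \<open>f\<close> and \<open>g\<close>; \<open>f'\<close> is the cobase change
  of \<open>f\<close> along \<open>g\<close>.\<close>

definition pushout :: "('o, 'm) cat \<Rightarrow> 'm \<Rightarrow> 'm \<Rightarrow> 'm \<Rightarrow> 'm \<Rightarrow> bool" where
  "pushout C f g f' g' \<longleftrightarrow>
    f \<in> Arr C \<and> g \<in> Arr C \<and> f' \<in> Arr C \<and> g' \<in> Arr C \<and>
    Dom C f = Dom C g \<and> Dom C f' = Cod C g \<and> Dom C g' = Cod C f \<and> Cod C f' = Cod C g' \<and>
    f' \<cdot>\<^bsub>C\<^esub> g = g' \<cdot>\<^bsub>C\<^esub> f \<and>
    (\<forall>X\<in>Obj C. \<forall>a\<in>Hom C (Cod C g) X. \<forall>b\<in>Hom C (Cod C f) X. a \<cdot>\<^bsub>C\<^esub> g = b \<cdot>\<^bsub>C\<^esub> f \<longrightarrow>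
      (\<exists>!u. u \<in> Hom C (Cod C f') X \<and> u \<cdot>\<^bsub>C\<^esub> f' = a \<and> u \<cdot>\<^bsub>C\<^esub> g' = b))"

text \<open>The square \<open>g \<cdot> f' = f \<cdot> g'\<close> is a pullback of \<open>f\<close> and \<open>g\<close>; \<open>f'\<close> is the base change
  of \<open>f\<close> along \<open>g\<close>.\<close>

definition pullback :: "('o, 'm) cat \<Rightarrow> 'm \<Rightarrow> 'm \<Rightarrow> 'm \<Rightarrow> 'm \<Rightarrow> bool" where
  "pullback C f g f' g' \<longleftrightarrow>
    f \<in> Arr C \<and> g \<in> Arr C \<and> f' \<in> Arr C \<and> g' \<in> Arr C \<and>
    Cod C f = Cod C g \<and> Cod C f' = Dom C g \<and> Cod C g' = Dom C f \<and> Dom C f' = Dom C g' \<and>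
    g \<cdot>\<^bsub>C\<^esub> f' = f \<cdot>\<^bsub>C\<^esub> g' \<and>
    (\<forall>X\<in>Obj C. \<forall>a\<in>Hom C X (Dom C g). \<forall>b\<in>Hom C X (Dom C f). g \<cdot>\<^bsub>C\<^esub> a = f \<cdot>\<^bsub>C\<^esub> b \<longrightarrow>
      (\<exists>!u. u \<in> Hom C X (Dom C f') \<and> f' \<cdot>\<^bsub>C\<^esub> u = a \<and> g' \<cdot>\<^bsub>C\<^esub> u = b))"

definition composable_pair :: "('o, 'm) cat \<Rightarrow> 'm \<times> 'm \<Rightarrow> bool" where
  "composable_pair C s \<longleftrightarrow> fst s \<in> Arr C \<and> snd s \<in> Arr C \<and> Cod C (fst s) = Dom C (snd s)"

definition pair_iso :: "('o, 'm) cat \<Rightarrow> 'm \<times> 'm \<Rightarrow> 'm \<times> 'm \<Rightarrow> bool" where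
  "pair_iso C s t \<longleftrightarrow> composable_pair C s \<and> composable_pair C t \<and>
    (\<exists>a\<in>Hom C (Dom C (fst s)) (Dom C (fst t)).
     \<exists>b\<in>Hom C (Cod C (fst s)) (Cod C (fst t)).
     \<exists>c\<in>Hom C (Cod C (snd s)) (Cod C (snd t)).
       is_iso C a \<and> is_iso C b \<and> is_iso C c \<and>
       b \<cdot>\<^bsub>C\<^esub> fst s = fst t \<cdot>\<^bsub>C\<^esub> a \<and> c \<cdot>\<^bsub>C\<^esub> snd s = snd t \<cdot>\<^bsub>C\<^esub> b)"

text \<open>The morphism \<open>h\<close> is \<open>f \<oplus> g\<close> with respect to biproducts on the domains and on the
  codomains with injections \<open>i\<close>, \<open>j\<close> and \<open>i'\<close>, \<open>j'\<close>.\<close>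

definition sum_morphism :: "('o, 'm) cat \<Rightarrow> 'm \<Rightarrow> 'm \<Rightarrow> 'm \<Rightarrow> 'm \<Rightarrow> 'm \<Rightarrow> 'm \<Rightarrow> 'm \<Rightarrow> bool" where
  "sum_morphism C f g h i j i' j' \<longleftrightarrow> h \<cdot>\<^bsub>C\<^esub> i = i' \<cdot>\<^bsub>C\<^esub> f \<and> h \<cdot>\<^bsub>C\<^esub> j = j' \<cdot>\<^bsub>C\<^esub> g"

definition pair_direct_sum :: "('o, 'm) cat \<Rightarrow> 'm \<times> 'm \<Rightarrow> 'm \<times> 'm \<Rightarrow> 'm \<times> 'm \<Rightarrow> bool" where
  "pair_direct_sum C s t r \<longleftrightarrow>
    composable_pair C s \<and> composable_pair C t \<and> composable_pair C r \<and>
    (\<exists>i1 j1 p1 q1 i2 j2 p2 q2 i3 j3 p3 q3.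
      biproduct C (Dom C (fst s)) (Dom C (fst t)) (Dom C (fst r)) i1 j1 p1 q1 \<and>
      biproduct C (Cod C (fst s)) (Cod C (fst t)) (Cod C (fst r)) i2 j2 p2 q2 \<and>
      biproduct C (Cod C (snd s)) (Cod C (snd t)) (Cod C (snd r)) i3 j3 p3 q3 \<and>
      sum_morphism C (fst s) (fst t) (fst r) i1 j1 i2 j2 \<and>
      sum_morphism C (snd s) (snd t) (snd r) i2 j2 i3 j3)"

definition adm_mono :: "('m \<times> 'm) set \<Rightarrow> 'm \<Rightarrow> bool" where
  "adm_mono E f \<longleftrightarrow> (\<exists>g. (f, g) \<in> E)"

definition adm_epi :: "('m \<times> 'm) set \<Rightarrow> 'm \<Rightarrow> bool" where
  "adm_epi E g \<longleftrightarrow> (\<exists>f. (f, g) \<in> E)"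

text \<open>
  Quillen's exact categories, in the self-dual axiomatization of Keller and Buehler (in which
  Quillen's ``obscure axiom'' is a theorem). \<open>(f, g) \<in> E\<close> stands for a short exact sequence
  with admissible monomorphism \<open>f\<close> and admissible epimorphism \<open>g\<close>. Closure under direct
  sums and direct summands follows from the other axioms; it is listed as part of the
  convention on exact structures.
\<close>

locale exact_category = additive_category C
  for C :: "('o, 'm) cat" (structure) and E :: "('m \<times> 'm) set" +
  assumes ses_kernel: "(f, g) \<in> E \<Longrightarrow> is_kernel C f g"
    and ses_cokernel: "(f, g) \<in> E \<Longrightarrow> is_cokernel C g f"
    and ses_iso: "\<lbrakk>s \<in> E; pair_iso C s t\<rbrakk> \<Longrightarrow> t \<in> E"
    and ses_direct_sum: "\<lbrakk>s \<in> E; t \<in> E; pair_direct_sum C s t r\<rbrakk> \<Longrightarrow> r \<in> E"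
    and ses_summand: "\<lbrakk>r \<in> E; pair_direct_sum C s t r\<rbrakk> \<Longrightarrow> s \<in> E \<and> t \<in> E"
    and id_adm_mono: "X \<in> Obj C \<Longrightarrow> adm_mono E (Idn C X)"
    and id_adm_epi: "X \<in> Obj C \<Longrightarrow> adm_epi E (Idn C X)"
    and comp_adm_mono: "\<lbrakk>adm_mono E f; adm_mono E g; Cod C f = Dom C g\<rbrakk> \<Longrightarrow> adm_mono E (g \<cdot> f)"
    and comp_adm_epi: "\<lbrakk>adm_epi E f; adm_epi E g; Cod C f = Dom C g\<rbrakk> \<Longrightarrow> adm_epi E (g \<cdot> f)"
    and pushout_adm_mono: "\<lbrakk>adm_mono E f; g \<in> Arr C; Dom C g = Dom C f\<rbrakk>
      \<Longrightarrow> \<exists>f' g'. pushout C f g f' g' \<and> adm_mono E f'"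
    and pullback_adm_epi: "\<lbrakk>adm_epi E f; g \<in> Arr C; Cod C g = Cod C f\<rbrakk>
      \<Longrightarrow> \<exists>f' g'. pullback C f g f' g' \<and> adm_epi E f'"

definition projective :: "('o, 'm) cat \<Rightarrow> ('m \<times> 'm) set \<Rightarrow> 'o \<Rightarrow> bool" where
  "projective C E P \<longleftrightarrow> P \<in> Obj C \<and>
    (\<forall>g h. adm_epi E g \<and> h \<in> Hom C P (Cod C g) \<longrightarrow>
      (\<exists>u\<in>Hom C P (Dom C g). g \<cdot>\<^bsub>C\<^esub> u = h))"

definition injective :: "('o, 'm) cat \<Rightarrow> ('m \<times> 'm) set \<Rightarrow> 'o \<Rightarrow> bool" where
  "injective C E I \<longleftrightarrow> I \<in> Obj C \<and>
    (\<forall>f h. adm_mono E f \<and> h \<in> Hom C (Dom C f) I \<longrightarrow>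
      (\<exists>u\<in>Hom C (Cod C f) I. u \<cdot>\<^bsub>C\<^esub> f = h))"

definition enough_projectives :: "('o, 'm) cat \<Rightarrow> ('m \<times> 'm) set \<Rightarrow> bool" where
  "enough_projectives C E \<longleftrightarrow>
    (\<forall>X\<in>Obj C. \<exists>g. adm_epi E g \<and> Cod C g = X \<and> projective C E (Dom C g))"

definition enough_injectives :: "('o, 'm) cat \<Rightarrow> ('m \<times> 'm) set \<Rightarrow> bool" where
  "enough_injectives C E \<longleftrightarrow>
    (\<forall>X\<in>Obj C. \<exists>f. adm_mono E f \<and> Dom C f = X \<and> injective C E (Cod C f))"


section \<open>Krull--Schmidt categories\<close>

definition local_ring :: "('a, 'b) ring_scheme \<Rightarrow> bool" where
  "local_ring R \<longleftrightarrow> ring R \<and> \<one>\<^bsub>R\<^esub> \<noteq> \<zero>\<^bsub>R\<^esub> \<and>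
    (\<forall>x\<in>carrier R. \<forall>y\<in>carrier R. x \<oplus>\<^bsub>R\<^esub> y \<in> Units R \<longrightarrow> x \<in> Units R \<or> y \<in> Units R)"

definition End_ring :: "('o, 'm) cat \<Rightarrow> 'o \<Rightarrow> 'm ring" where
  "End_ring C X = \<lparr>carrier = Hom C X X, mult = Comp C, one = Idn C X,
    zero = Zero C X X, add = Add C\<rparr>"

text \<open>\<open>X = Y 0 \<oplus> \<dots> \<oplus> Y (n - 1)\<close>, with injections \<open>i k\<close> and projections \<open>p k\<close>; the zero
  object is the case \<open>n = 0\<close>. The \<open>finprod\<close> below is the sum of the \<open>i k \<cdot> p k\<close>.\<close>

definition finite_direct_sum ::
  "('o, 'm) cat \<Rightarrow> nat \<Rightarrow> (nat \<Rightarrow> 'o) \<Rightarrow> 'o \<Rightarrow> (nat \<Rightarrow> 'm) \<Rightarrow> (nat \<Rightarrow> 'm) \<Rightarrow> bool" where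
  "finite_direct_sum C n Y X i p \<longleftrightarrow> X \<in> Obj C \<and>
    (\<forall>k<n. Y k \<in> Obj C \<and> i k \<in> Hom C (Y k) X \<and> p k \<in> Hom C X (Y k)) \<and>
    (\<forall>k<n. \<forall>l<n. p l \<cdot>\<^bsub>C\<^esub> i k = (if k = l then Idn C (Y k) else Zero C (Y k) (Y l))) \<and>
    finprod (Hom_group C X X) (\<lambda>k. i k \<cdot>\<^bsub>C\<^esub> p k) {..<n} = Idn C X"

definition krull_schmidt :: "('o, 'm) cat \<Rightarrow> bool" where
  "krull_schmidt C \<longleftrightarrow> additive_category C \<and>
    (\<forall>X\<in>Obj C. \<exists>n Y i p. finite_direct_sum C n Y X i p \<and> (\<forall>k<n. local_ring (End_ring C (Y k))))"


section \<open>Extensions and cotorsion pairs\<close>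

text \<open>
  \<open>Ext1 C E X Y\<close> is the Yoneda Ext: equivalence classes of short exact sequences
  \<open>Y \<rightarrowtail> Z \<twoheadrightarrow> X\<close>. Its zero element is the class of the split sequences.
\<close>

definition extensions :: "('o, 'm) cat \<Rightarrow> ('m \<times> 'm) set \<Rightarrow> 'o \<Rightarrow> 'o \<Rightarrow> ('m \<times> 'm) set" where
  "extensions C E X Y = {(f, g). (f, g) \<in> E \<and> Dom C f = Y \<and> Cod C g = X}"

definition ext_equiv ::
  "('o, 'm) cat \<Rightarrow> ('m \<times> 'm) set \<Rightarrow> 'o \<Rightarrow> 'o \<Rightarrow> (('m \<times> 'm) \<times> ('m \<times> 'm)) set" where
  "ext_equiv C E X Y = {((f, g), (f', g')).
    (f, g) \<in> extensions C E X Y \<and> (f', g') \<in> extensions C E X Y \<and>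
    (\<exists>h\<in>Hom C (Cod C f) (Cod C f'). is_iso C h \<and> h \<cdot>\<^bsub>C\<^esub> f = f' \<and> g' \<cdot>\<^bsub>C\<^esub> h = g)}"

definition Ext1 :: "('o, 'm) cat \<Rightarrow> ('m \<times> 'm) set \<Rightarrow> 'o \<Rightarrow> 'o \<Rightarrow> ('m \<times> 'm) set set" where
  "Ext1 C E X Y = extensions C E X Y // ext_equiv C E X Y"

definition Ext1_zero :: "('o, 'm) cat \<Rightarrow> ('m \<times> 'm) set \<Rightarrow> 'o \<Rightarrow> 'o \<Rightarrow> ('m \<times> 'm) set" where
  "Ext1_zero C E X Y = {(f, g). (f, g) \<in> extensions C E X Y \<and>
    (\<exists>j p. biproduct C Y X (Cod C f) f j p g)}"

definition full_sub :: "('o, 'm) cat \<Rightarrow> 'o set \<Rightarrow> ('o, 'm) cat" where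
  "full_sub C A = C\<lparr>Obj := A, Arr := {f \<in> Arr C. Dom C f \<in> A \<and> Cod C f \<in> A}\<rparr>"

definition direct_summand :: "('o, 'm) cat \<Rightarrow> 'o \<Rightarrow> 'o \<Rightarrow> bool" where
  "direct_summand C X Z \<longleftrightarrow> (\<exists>Y i j p q. biproduct C X Y Z i j p q)"

text \<open>A full subcategory is given by its set of objects.\<close>

definition additive_sub :: "('o, 'm) cat \<Rightarrow> 'o set \<Rightarrow> bool" where
  "additive_sub C A \<longleftrightarrow> A \<subseteq> Obj C \<and> additive_category (full_sub C A)"

definition summand_closed :: "('o, 'm) cat \<Rightarrow> 'o set \<Rightarrow> bool" where
  "summand_closed C A \<longleftrightarrow> (\<forall>Z\<in>A. \<forall>X. direct_summand C X Z \<longrightarrow> X \<in> A)"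

definition ses :: "('o, 'm) cat \<Rightarrow> ('m \<times> 'm) set \<Rightarrow> 'o \<Rightarrow> 'o \<Rightarrow> 'o \<Rightarrow> bool" where
  "ses C E X Y Z \<longleftrightarrow> (\<exists>f g. (f, g) \<in> E \<and> f \<in> Hom C X Y \<and> g \<in> Hom C Y Z)"

definition cotorsion_pair :: "('o, 'm) cat \<Rightarrow> ('m \<times> 'm) set \<Rightarrow> 'o set \<Rightarrow> 'o set \<Rightarrow> bool" where
  "cotorsion_pair C E U V \<longleftrightarrow>
    additive_sub C U \<and> summand_closed C U \<and> additive_sub C V \<and> summand_closed C V \<and>
    (\<forall>X\<in>U. \<forall>Y\<in>V. Ext1 C E X Y = {Ext1_zero C E X Y}) \<and>
    (\<forall>B\<in>Obj C. (\<exists>V\<^sub>B\<in>V. \<exists>U\<^sub>B\<in>U. ses C E V\<^sub>B U\<^sub>B B) \<and> (\<exists>V\<^sub>B\<in>V. \<exists>U\<^sub>B\<in>U. ses C E B V\<^sub>B U\<^sub>B))"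

definition twin_cotorsion_pair ::
  "('o, 'm) cat \<Rightarrow> ('m \<times> 'm) set \<Rightarrow> 'o set \<Rightarrow> 'o set \<Rightarrow> 'o set \<Rightarrow> 'o set \<Rightarrow> bool" where
  "twin_cotorsion_pair C E S T U V \<longleftrightarrow>
    cotorsion_pair C E S T \<and> cotorsion_pair C E U V \<and> S \<subseteq> U"


section \<open>Quotient categories and the heart\<close>

definition factors_through :: "('o, 'm) cat \<Rightarrow> 'o set \<Rightarrow> 'm \<Rightarrow> bool" where
  "factors_through C W f \<longleftrightarrow>
    (\<exists>Y\<in>W. \<exists>a\<in>Hom C (Dom C f) Y. \<exists>b\<in>Hom C Y (Cod C f). f = b \<cdot>\<^bsub>C\<^esub> a)"

text \<open>The residue class of \<open>f\<close> modulo the morphisms factoring through an object of \<open>W\<close>.\<close>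

definition residue_class :: "('o, 'm) cat \<Rightarrow> 'o set \<Rightarrow> 'm \<Rightarrow> 'm set" where
  "residue_class C W f =
    {f \<boxplus>\<^bsub>C\<^esub> h |h. h \<in> Hom C (Dom C f) (Cod C f) \<and> factors_through C W h}"

definition representative :: "'m set \<Rightarrow> 'm" where
  "representative F = (SOME f. f \<in> F)"

text \<open>The quotient \<open>C/W\<close>. The operations are computed on representatives, and do not depend on
  their choice as long as \<open>W\<close> is an additive subcategory.\<close>

definition quotient_cat :: "('o, 'm) cat \<Rightarrow> 'o set \<Rightarrow> ('o, 'm set) cat" where
  "quotient_cat C W =
    \<lparr>Obj = Obj C,
     Arr = residue_class C W ` Arr C,
     Dom = (\<lambda>F. Dom C (representative F)),
     Cod = (\<lambda>F. Cod C (representative F)),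
     Idn = (\<lambda>X. residue_class C W (Idn C X)),
     Comp = (\<lambda>G F. residue_class C W (representative G \<cdot>\<^bsub>C\<^esub> representative F)),
     Zero = (\<lambda>X Y. residue_class C W (Zero C X Y)),
     Add = (\<lambda>F G. residue_class C W (representative F \<boxplus>\<^bsub>C\<^esub> representative G))\<rparr>"

definition Bplus :: "('o, 'm) cat \<Rightarrow> ('m \<times> 'm) set \<Rightarrow> 'o set \<Rightarrow> 'o set \<Rightarrow> 'o set" where
  "Bplus C E W V = {B \<in> Obj C. \<exists>V\<^sub>B\<in>V. \<exists>U\<^sub>B\<in>W. ses C E V\<^sub>B U\<^sub>B B}"

definition Bminus :: "('o, 'm) cat \<Rightarrow> ('m \<times> 'm) set \<Rightarrow> 'o set \<Rightarrow> 'o set \<Rightarrow> 'o set" where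
  "Bminus C E W S = {B \<in> Obj C. \<exists>T\<^sub>B\<in>W. \<exists>S\<^sub>B\<in>S. ses C E B T\<^sub>B S\<^sub>B}"

definition heart ::
  "('o, 'm) cat \<Rightarrow> ('m \<times> 'm) set \<Rightarrow> 'o set \<Rightarrow> 'o set \<Rightarrow> 'o set \<Rightarrow> 'o set \<Rightarrow> ('o, 'm set) cat" where
  "heart C E S T U V =
    (let W = T \<inter> U; H = Bplus C E W V \<inter> Bminus C E W S
     in quotient_cat (full_sub C H) W)"

end

theory Submission
  imports Defs
begin

text \<open>
  Write \<open>\<W> = T \<inter> U\<close>, and call a morphism negligible if it factors through an object of \<open>\<W>\<close>. The
  heart is additive because \<open>\<B>\<^sup>+\<close>, \<open>\<B>\<^sup>-\<close> and \<open>\<W>\<close> are closed under direct sums and \<open>\<W>\<close> is contained in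
  \<open>\<H>\<close>; what has to be found is a cokernel of a morphism \<open>f : A \<rightarrow> B\<close> between objects of \<open>\<H>\<close>.

  Take the sequence \<open>A \<rightarrowtail> W' \<twoheadrightarrow> S'\<close> that puts \<open>A\<close> in \<open>\<B>\<^sup>-\<close>. As \<open>Ext\<^sup>1(S, T) = 0\<close>, every negligible
  morphism out of \<open>A\<close> extends to \<open>W'\<close>. Hence a morphism \<open>g\<close> on \<open>B\<close> with \<open>g \<cdot> f\<close> negligible factors
  through the pushout \<open>m : B \<rightarrowtail> M\<close> of \<open>A \<rightarrowtail> W'\<close> along \<open>f\<close>, while \<open>m \<cdot> f\<close> is negligible. The object \<open>M\<close>
  is in \<open>\<B>\<^sup>-\<close> (lemma \<open>Bm_extension\<close>) but need not be in \<open>\<B>\<^sup>+\<close>, so it is followed by its reflection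
  \<open>c : M \<rightarrowtail> M\<^sup>+\<close> into \<open>\<B>\<^sup>+\<close> (lemma \<open>reflection\<close>), through which all morphisms from \<open>M\<close> to objects of
  \<open>\<B>\<^sup>+\<close> factor, and which again stays in \<open>\<B>\<^sup>-\<close>. Uniqueness modulo negligible morphisms holds because
  both \<open>m\<close> and \<open>c\<close> are admissible monomorphisms with cokernel in \<open>S\<close>: a morphism into \<open>\<B>\<^sup>+\<close> is negligible
  as soon as its composite with such a monomorphism is (lemma \<open>negligible_if_comp_negligible\<close>).
  Together, \<open>c \<cdot> m\<close> represents the cokernel of \<open>f\<close> in \<open>\<H>/\<W>\<close>.

  Kernels are obtained by duality. The opposite of an exact category is exact, and
  \<open>(V, U)\<close>, \<open>(T, S)\<close> is a twin cotorsion pair on it; passing to it exchanges \<open>\<B>\<^sup>+\<close> with \<open>\<B>\<^sup>-\<close>, keeps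
  \<open>\<W>\<close>, and replaces the heart by its opposite (lemma \<open>heart_op\<close>).
\<close>

section \<open>Calculating in preadditive categories\<close>

lemma in_Hom: "f \<in> Hom C X Y \<longleftrightarrow> f \<in> Arr C \<and> Dom C f = X \<and> Cod C f = Y"
  by (auto simp: Hom_def)

context category
begin

lemma id_arr [simp]:
  assumes "X \<in> Obj C"
  shows "Idn C X \<in> Arr C" "Dom C (Idn C X) = X" "Cod C (Idn C X) = X"
  using id_hom[OF assms] by (auto simp: in_Hom)

lemma comp_arr [simp]:
  assumes "f \<in> Arr C" "g \<in> Arr C" "Cod C f = Dom C g"
  shows "g \<cdot> f \<in> Arr C" "Dom C (g \<cdot> f) = Dom C f" "Cod C (g \<cdot> f) = Cod C g"
  using comp_hom[of f "Dom C f" "Cod C f" g "Cod C g"] assms by (auto simp: in_Hom)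

lemma comp_id [simp]:
  assumes "f \<in> Arr C"
  shows "Cod C f = X \<Longrightarrow> Idn C X \<cdot> f = f" "Dom C f = X \<Longrightarrow> f \<cdot> Idn C X = f"
  using comp_id_left[of f "Dom C f"] comp_id_right[of f "Dom C f"] assms by (auto simp: in_Hom)

lemma assoc:
  assumes "f \<in> Arr C" "g \<in> Arr C" "h \<in> Arr C" "Cod C f = Dom C g" "Cod C g = Dom C h"
  shows "(h \<cdot> g) \<cdot> f = h \<cdot> (g \<cdot> f)"
  using comp_assoc[of f "Dom C f" "Cod C f" g "Cod C g" h "Cod C h"] assms by (auto simp: in_Hom)

text \<open>Lets the simplifier use an equation \<open>h \<cdot> g = k\<close> inside a composite that is bracketed to the
  right.\<close>

lemma reassoc:
  assumes "h \<cdot> g = k" "f \<in> Arr C" "g \<in> Arr C" "h \<in> Arr C" "Cod C f = Dom C g"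
    "Cod C g = Dom C h"
  shows "h \<cdot> (g \<cdot> f) = k \<cdot> f"
  using assoc[of f g h] assms by simp

lemma dom_cod_obj [simp]: "f \<in> Arr C \<Longrightarrow> Dom C f \<in> Obj C" "f \<in> Arr C \<Longrightarrow> Cod C f \<in> Obj C"
  by (fact dom_obj, fact cod_obj)

end

context preadditive_category
begin

lemma zero_arr [simp]:
  assumes "X \<in> Obj C" "Y \<in> Obj C"
  shows "Zero C X Y \<in> Arr C" "Dom C (Zero C X Y) = X" "Cod C (Zero C X Y) = Y"
proof -
  interpret comm_group "Hom_group C X Y" by (rule hom_group[OF assms])
  have "Zero C X Y \<in> Hom C X Y" using one_closed by (simp add: Hom_group_def)
  then show "Zero C X Y \<in> Arr C" "Dom C (Zero C X Y) = X" "Cod C (Zero C X Y) = Y"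
    by (auto simp: in_Hom)
qed

lemma add_arr [simp]:
  assumes "f \<in> Arr C" "g \<in> Arr C" "Dom C f = Dom C g" "Cod C f = Cod C g"
  shows "f \<boxplus> g \<in> Arr C" "Dom C (f \<boxplus> g) = Dom C g" "Cod C (f \<boxplus> g) = Cod C g"
proof -
  interpret comm_group "Hom_group C (Dom C g) (Cod C g)" using assms by (intro hom_group) auto
  have "f \<boxplus> g \<in> Hom C (Dom C g) (Cod C g)"
    using m_closed[of f g] assms by (simp add: Hom_group_def in_Hom)
  then show "f \<boxplus> g \<in> Arr C" "Dom C (f \<boxplus> g) = Dom C g" "Cod C (f \<boxplus> g) = Cod C g"
    by (auto simp: in_Hom)
qed

lemma add_comm:
  assumes "f \<in> Arr C" "g \<in> Arr C" "Dom C f = Dom C g" "Cod C f = Cod C g"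
  shows "f \<boxplus> g = g \<boxplus> f"
proof -
  interpret comm_group "Hom_group C (Dom C g) (Cod C g)" using assms by (intro hom_group) auto
  show ?thesis using m_comm[of f g] assms by (simp add: Hom_group_def in_Hom)
qed

lemma add_assoc:
  assumes "f \<in> Arr C" "g \<in> Arr C" "h \<in> Arr C"
    "Dom C f = Dom C g" "Cod C f = Cod C g" "Dom C g = Dom C h" "Cod C g = Cod C h"
  shows "(f \<boxplus> g) \<boxplus> h = f \<boxplus> (g \<boxplus> h)"
proof -
  interpret comm_group "Hom_group C (Dom C h) (Cod C h)" using assms by (intro hom_group) auto
  show ?thesis using m_assoc[of f g h] assms by (simp add: Hom_group_def in_Hom)
qed

lemma add_zero [simp]:
  assumes "f \<in> Arr C" "Dom C f = X" "Cod C f = Y"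
  shows "f \<boxplus> Zero C X Y = f" "Zero C X Y \<boxplus> f = f"
proof -
  interpret comm_group "Hom_group C X Y" using assms by (intro hom_group) auto
  show "f \<boxplus> Zero C X Y = f" "Zero C X Y \<boxplus> f = f"
    using r_one[of f] l_one[of f] assms by (simp_all add: Hom_group_def in_Hom)
qed

lemma add_cancel:
  assumes "f \<in> Arr C" "g \<in> Arr C" "h \<in> Arr C" "Dom C f = Dom C g" "Cod C f = Cod C g"
    "Dom C h = Dom C g" "Cod C h = Cod C g" "f \<boxplus> g = f \<boxplus> h"
  shows "g = h"
proof -
  interpret comm_group "Hom_group C (Dom C g) (Cod C g)" using assms by (intro hom_group) auto
  show ?thesis using Units_l_cancel[of f g h] Units_eq assms by (simp add: Hom_group_def in_Hom)
qed

lemma ex_diff: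
  assumes "f \<in> Arr C" "g \<in> Arr C" "Dom C f = Dom C g" "Cod C f = Cod C g"
  obtains d where "d \<in> Arr C" "Dom C d = Dom C g" "Cod C d = Cod C g" "f = g \<boxplus> d"
proof -
  interpret comm_group "Hom_group C (Dom C g) (Cod C g)" using assms by (intro hom_group) auto
  let ?d = "inv\<^bsub>Hom_group C (Dom C g) (Cod C g)\<^esub> g \<otimes>\<^bsub>Hom_group C (Dom C g) (Cod C g)\<^esub> f"
  have c: "f \<in> carrier (Hom_group C (Dom C g) (Cod C g))"
    "g \<in> carrier (Hom_group C (Dom C g) (Cod C g))"
    using assms by (auto simp: Hom_group_def in_Hom)
  have "?d \<in> carrier (Hom_group C (Dom C g) (Cod C g))" using c by simp
  moreover have "g \<otimes>\<^bsub>Hom_group C (Dom C g) (Cod C g)\<^esub> ?d = f"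
    using c by (simp add: m_assoc[symmetric])
  ultimately show ?thesis by (intro that[of ?d]) (auto simp: Hom_group_def in_Hom)
qed

lemma comp_add [simp]:
  assumes "f \<in> Arr C" "f' \<in> Arr C" "g \<in> Arr C" "Dom C f = Dom C f'" "Cod C f = Cod C f'"
  shows "Cod C f' = Dom C g \<Longrightarrow> g \<cdot> (f \<boxplus> f') = g \<cdot> f \<boxplus> g \<cdot> f'"
    "Dom C f' = Cod C g \<Longrightarrow> (f \<boxplus> f') \<cdot> g = f \<cdot> g \<boxplus> f' \<cdot> g"
  using comp_add_right[of f "Dom C f" "Cod C f" f' g "Cod C g"]
    comp_add_left[of g "Dom C g" "Cod C g" f "Cod C f" f'] assms by (auto simp: in_Hom)

lemma comp_zero [simp]:
  assumes "g \<in> Arr C" "X \<in> Obj C"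
  shows "Y = Dom C g \<Longrightarrow> g \<cdot> Zero C X Y = Zero C X (Cod C g)"
    "Y = Cod C g \<Longrightarrow> Zero C Y X \<cdot> g = Zero C (Dom C g) X"
proof -
  let ?z = "Zero C X (Dom C g)" and ?z' = "Zero C (Cod C g) X"
  have "g \<cdot> ?z \<boxplus> g \<cdot> ?z = g \<cdot> (?z \<boxplus> ?z)" "?z' \<cdot> g \<boxplus> ?z' \<cdot> g = (?z' \<boxplus> ?z') \<cdot> g"
    using assms by (simp_all del: add_zero)
  then have e: "g \<cdot> ?z \<boxplus> g \<cdot> ?z = g \<cdot> ?z \<boxplus> Zero C X (Cod C g)"
    "?z' \<cdot> g \<boxplus> ?z' \<cdot> g = ?z' \<cdot> g \<boxplus> Zero C (Dom C g) X"
    using assms by simp_all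
  show "Y = Dom C g \<Longrightarrow> g \<cdot> Zero C X Y = Zero C X (Cod C g)"
    "Y = Cod C g \<Longrightarrow> Zero C Y X \<cdot> g = Zero C (Dom C g) X"
    using add_cancel[OF _ _ _ _ _ _ _ e(1)] add_cancel[OF _ _ _ _ _ _ _ e(2)] assms by auto
qed

lemma biproduct_swap: "biproduct C X Y Z i j p q \<Longrightarrow> biproduct C Y X Z j i q p"
  unfolding biproduct_def by (auto simp: in_Hom add_comm)

text \<open>A direct sum of morphisms is characterized by its compatibility with the injections; dually it
  would be with the projections. That the first implies the second makes direct sums of sequences
  self-dual.\<close>

lemma sum_morphism_projections:
  assumes "biproduct C X Y Z i j p q" "biproduct C X' Y' Z' i' j' p' q'"
    and "f \<in> Hom C X X'" "g \<in> Hom C Y Y'" "h \<in> Hom C Z Z'"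
    and "h \<cdot> i = i' \<cdot> f" "h \<cdot> j = j' \<cdot> g"
  shows "p' \<cdot> h = f \<cdot> p" "q' \<cdot> h = g \<cdot> q"
proof -
  note b = assms(1-5)[unfolded biproduct_def in_Hom]
  have "h = h \<cdot> (i \<cdot> p \<boxplus> j \<cdot> q)" using b by simp
  also have "\<dots> = h \<cdot> (i \<cdot> p) \<boxplus> h \<cdot> (j \<cdot> q)"
    using b by (intro comp_add) auto
  also have "\<dots> = (h \<cdot> i) \<cdot> p \<boxplus> (h \<cdot> j) \<cdot> q" using b by (simp add: assoc)
  also have "\<dots> = i' \<cdot> (f \<cdot> p) \<boxplus> j' \<cdot> (g \<cdot> q)" using b by (simp add: assms assoc)
  finally have h: "h = i' \<cdot> (f \<cdot> p) \<boxplus> j' \<cdot> (g \<cdot> q)" .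
  have e: "p' \<cdot> i' = Idn C X'" "q' \<cdot> j' = Idn C Y'" "q' \<cdot> i' = Zero C X' Y'"
    "p' \<cdot> j' = Zero C Y' X'"
    using b by auto
  show "p' \<cdot> h = f \<cdot> p" "q' \<cdot> h = g \<cdot> q"
    using b by (simp_all add: h e[THEN reassoc])
qed

end

section \<open>Duality\<close>

definition op_cat :: "('o, 'm) cat \<Rightarrow> ('o, 'm) cat" where
  "op_cat C = \<lparr>Obj = Obj C, Arr = Arr C, Dom = Cod C, Cod = Dom C, Idn = Idn C,
    Comp = (\<lambda>g f. f \<cdot>\<^bsub>C\<^esub> g), Zero = (\<lambda>X Y. Zero C Y X), Add = Add C\<rparr>"

lemma op_cat_simps [simp]:
  "Obj (op_cat C) = Obj C" "Arr (op_cat C) = Arr C" "Dom (op_cat C) = Cod C"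
  "Cod (op_cat C) = Dom C" "Idn (op_cat C) = Idn C" "g \<cdot>\<^bsub>op_cat C\<^esub> f = f \<cdot>\<^bsub>C\<^esub> g"
  "Zero (op_cat C) X Y = Zero C Y X" "Add (op_cat C) = Add C"
  by (simp_all add: op_cat_def)

lemma Hom_op [simp]: "Hom (op_cat C) X Y = Hom C Y X"
  by (auto simp: in_Hom)

lemma Hom_group_op: "Hom_group (op_cat C) X Y = Hom_group C Y X"
  by (simp add: Hom_group_def)

lemma zero_object_op: "zero_object (op_cat C) Z \<longleftrightarrow> zero_object C Z"
  by (simp add: zero_object_def conj_commute)

lemma biproduct_op [simp]: "biproduct (op_cat C) X Y Z i j p q \<longleftrightarrow> biproduct C X Y Z p q i j"
  by (auto simp: biproduct_def)

lemma is_cokernel_op [simp]: "is_cokernel (op_cat C) c f \<longleftrightarrow> is_kernel C c f"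
  by (simp add: is_cokernel_def is_kernel_def)

lemma is_kernel_op [simp]: "is_kernel (op_cat C) k f \<longleftrightarrow> is_cokernel C k f"
  by (simp add: is_cokernel_def is_kernel_def)

lemma pushout_op [simp]: "pushout (op_cat C) f g f' g' \<longleftrightarrow> pullback C f g f' g'"
  by (simp add: pushout_def pullback_def)

lemma pullback_op [simp]: "pullback (op_cat C) f g f' g' \<longleftrightarrow> pushout C f g f' g'"
  by (simp add: pushout_def pullback_def)

lemma adm_op [simp]:
  "adm_mono (E\<inverse>) f \<longleftrightarrow> adm_epi E f" "adm_epi (E\<inverse>) f \<longleftrightarrow> adm_mono E f"
  by (auto simp: adm_mono_def adm_epi_def)

lemma ses_op [simp]: "ses (op_cat C) (E\<inverse>) X Y Z \<longleftrightarrow> ses C E Z Y X"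
  by (auto simp: ses_def)

lemma summand_closed_op [simp]: "summand_closed (op_cat C) A \<longleftrightarrow> summand_closed C A"
proof -
  have "direct_summand (op_cat C) X Z \<longleftrightarrow> direct_summand C X Z" for X Z
    unfolding direct_summand_def biproduct_op by blast
  then show ?thesis by (simp add: summand_closed_def)
qed

lemma is_iso_op: "is_iso (op_cat C) f \<longleftrightarrow> is_iso C f"
  by (auto simp: is_iso_def)

lemma (in category) category_op: "category (op_cat C)"
  by unfold_locales (auto simp: in_Hom assoc)

lemma (in preadditive_category) preadditive_category_op: "preadditive_category (op_cat C)"
  by (intro preadditive_category.intro category_op preadditive_category_axioms.intro)
    (auto simp: in_Hom Hom_group_op hom_group)

lemma (in additive_category) additive_category_op: "additive_category (op_cat C)"
proof (intro additive_category.intro preadditive_category_op additive_category_axioms.intro)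
  show "\<exists>Z. zero_object (op_cat C) Z" using ex_zero_object by (simp add: zero_object_op)
  show "\<exists>Z i j p q. biproduct (op_cat C) X Y Z i j p q"
    if "X \<in> Obj (op_cat C)" "Y \<in> Obj (op_cat C)" for X Y
    using ex_biproduct[of X Y] that unfolding biproduct_op by simp blast
qed

lemma (in category) is_iso_inverse:
  assumes "is_iso C a"
  obtains a' where "a' \<in> Arr C" "Dom C a' = Cod C a" "Cod C a' = Dom C a" "is_iso C a'"
    "a' \<cdot> a = Idn C (Dom C a)" "a \<cdot> a' = Idn C (Cod C a)"
proof -
  obtain a' where "a \<in> Arr C" "a' \<in> Hom C (Cod C a) (Dom C a)"
    "a' \<cdot> a = Idn C (Dom C a)" "a \<cdot> a' = Idn C (Cod C a)"
    using assms unfolding is_iso_def by blast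
  then show ?thesis
    by (intro that[of a']) (auto simp: is_iso_def in_Hom intro!: bexI[of _ a])
qed

text \<open>Passing to the opposite category reverses the direction of the vertical isomorphisms, so symmetry
  is what makes closure under isomorphism self-dual.\<close>

lemma (in category) pair_iso_sym:
  assumes "pair_iso C s t"
  shows "pair_iso C t s"
proof -
  have inverse_square: "b' \<cdot> y = x \<cdot> a'"
    if "x \<in> Arr C" "y \<in> Arr C" "a \<in> Arr C" "b \<in> Arr C" "a' \<in> Arr C" "b' \<in> Arr C"
      "Dom C a = Dom C x" "Cod C a = Dom C y" "Dom C b = Cod C x" "Cod C b = Cod C y"
      "Dom C a' = Cod C a" "Cod C a' = Dom C a" "Dom C b' = Cod C b" "Cod C b' = Dom C b"
      "b' \<cdot> b = Idn C (Dom C b)" "a \<cdot> a' = Idn C (Cod C a)" "b \<cdot> x = y \<cdot> a"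
    for x y a b a' b'
  proof -
    have "b' \<cdot> y = b' \<cdot> (y \<cdot> (a \<cdot> a'))" using that by simp
    also have "\<dots> = b' \<cdot> ((y \<cdot> a) \<cdot> a')" using that by (simp add: assoc)
    also have "\<dots> = b' \<cdot> ((b \<cdot> x) \<cdot> a')" using that by simp
    also have "\<dots> = (b' \<cdot> b) \<cdot> (x \<cdot> a')" using that(1-14) by (simp add: assoc)
    finally show ?thesis using that by simp
  qed
  obtain a b c where abc: "a \<in> Hom C (Dom C (fst s)) (Dom C (fst t))"
    "b \<in> Hom C (Cod C (fst s)) (Cod C (fst t))" "c \<in> Hom C (Cod C (snd s)) (Cod C (snd t))"
    "is_iso C a" "is_iso C b" "is_iso C c"
    "b \<cdot> fst s = fst t \<cdot> a" "c \<cdot> snd s = snd t \<cdot> b"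
    and st: "composable_pair C s" "composable_pair C t"
    using assms unfolding pair_iso_def by auto
  obtain a' where a': "a' \<in> Arr C" "Dom C a' = Cod C a" "Cod C a' = Dom C a" "is_iso C a'"
    "a' \<cdot> a = Idn C (Dom C a)" "a \<cdot> a' = Idn C (Cod C a)" by (rule is_iso_inverse[OF abc(4)])
  obtain b' where b': "b' \<in> Arr C" "Dom C b' = Cod C b" "Cod C b' = Dom C b" "is_iso C b'"
    "b' \<cdot> b = Idn C (Dom C b)" "b \<cdot> b' = Idn C (Cod C b)" by (rule is_iso_inverse[OF abc(5)])
  obtain c' where c': "c' \<in> Arr C" "Dom C c' = Cod C c" "Cod C c' = Dom C c" "is_iso C c'"
    "c' \<cdot> c = Idn C (Dom C c)" "c \<cdot> c' = Idn C (Cod C c)" by (rule is_iso_inverse[OF abc(6)])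
  have "b' \<cdot> fst t = fst s \<cdot> a'"
    by (rule inverse_square[of _ _ a b])
      (use abc a' b' st in \<open>auto simp: in_Hom composable_pair_def\<close>)
  moreover have "c' \<cdot> snd t = snd s \<cdot> b'"
    by (rule inverse_square[of _ _ b c])
      (use abc b' c' st in \<open>auto simp: in_Hom composable_pair_def\<close>)
  ultimately show ?thesis
    using abc a' b' c' st unfolding pair_iso_def in_Hom
    by (intro conjI bexI[of _ a'] bexI[of _ b'] bexI[of _ c']) (auto simp: in_Hom)
qed

lemma composable_pair_op: "composable_pair (op_cat C) s \<longleftrightarrow> composable_pair C (prod.swap s)"
  by (auto simp: composable_pair_def)

lemma (in category) pair_iso_op:
  assumes "pair_iso (op_cat C) s t"
  shows "pair_iso C (prod.swap s) (prod.swap t)"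
proof (rule pair_iso_sym)
  obtain a b c where abc: "a \<in> Hom C (Cod C (fst t)) (Cod C (fst s))"
    "b \<in> Hom C (Dom C (fst t)) (Dom C (fst s))" "c \<in> Hom C (Dom C (snd t)) (Dom C (snd s))"
    "is_iso C a" "is_iso C b" "is_iso C c"
    "fst s \<cdot> b = a \<cdot> fst t" "snd s \<cdot> c = b \<cdot> snd t"
    and st: "composable_pair C (prod.swap s)" "composable_pair C (prod.swap t)"
    using assms unfolding pair_iso_def composable_pair_op by (auto simp: is_iso_op)
  then show "pair_iso C (prod.swap t) (prod.swap s)"
    unfolding pair_iso_def
    by (intro conjI bexI[of _ a] bexI[of _ b] bexI[of _ c]) (auto simp: composable_pair_def)
qed

lemma (in preadditive_category) pair_direct_sum_op:
  assumes "pair_direct_sum (op_cat C) s t r"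
  shows "pair_direct_sum C (prod.swap s) (prod.swap t) (prod.swap r)"
proof -
  interpret op: preadditive_category "op_cat C" by (rule preadditive_category_op)
  obtain i1 j1 p1 q1 i2 j2 p2 q2 i3 j3 p3 q3 where
    b: "biproduct (op_cat C) (Cod C (fst s)) (Cod C (fst t)) (Cod C (fst r)) i1 j1 p1 q1"
      "biproduct (op_cat C) (Dom C (fst s)) (Dom C (fst t)) (Dom C (fst r)) i2 j2 p2 q2"
      "biproduct (op_cat C) (Dom C (snd s)) (Dom C (snd t)) (Dom C (snd r)) i3 j3 p3 q3"
    and m: "sum_morphism (op_cat C) (fst s) (fst t) (fst r) i1 j1 i2 j2"
      "sum_morphism (op_cat C) (snd s) (snd t) (snd r) i2 j2 i3 j3"
    and c: "composable_pair (op_cat C) s" "composable_pair (op_cat C) t"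
      "composable_pair (op_cat C) r"
    using assms unfolding pair_direct_sum_def by auto
  have "p2 \<cdot>\<^bsub>op_cat C\<^esub> fst r = fst s \<cdot>\<^bsub>op_cat C\<^esub> p1" "q2 \<cdot>\<^bsub>op_cat C\<^esub> fst r = fst t \<cdot>\<^bsub>op_cat C\<^esub> q1"
    using op.sum_morphism_projections[OF b(1,2), of "fst s" "fst t" "fst r"] m(1) c
    by (auto simp: in_Hom composable_pair_def sum_morphism_def)
  moreover have "p3 \<cdot>\<^bsub>op_cat C\<^esub> snd r = snd s \<cdot>\<^bsub>op_cat C\<^esub> p2"
    "q3 \<cdot>\<^bsub>op_cat C\<^esub> snd r = snd t \<cdot>\<^bsub>op_cat C\<^esub> q2"
    using op.sum_morphism_projections[OF b(2,3), of "snd s" "snd t" "snd r"] m(2) c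
    by (auto simp: in_Hom composable_pair_def sum_morphism_def)
  ultimately have n: "sum_morphism C (snd s) (snd t) (snd r) p3 q3 p2 q2"
    "sum_morphism C (fst s) (fst t) (fst r) p2 q2 p1 q1"
    by (auto simp: sum_morphism_def)
  have e: "Cod C (snd s) = Dom C (fst s)" "Cod C (snd t) = Dom C (fst t)"
     "Cod C (snd r) = Dom C (fst r)"
    using c by (auto simp: composable_pair_def)
  from n b c show ?thesis
    unfolding pair_direct_sum_def composable_pair_op biproduct_op fst_swap snd_swap e by blast
qed

lemma (in exact_category) exact_category_op: "exact_category (op_cat C) (E\<inverse>)"
proof -
  interpret op: additive_category "op_cat C" by (rule additive_category_op)
  have swap: "s \<in> E\<inverse> \<longleftrightarrow> prod.swap s \<in> E" for s by (cases s) auto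
  show ?thesis
  proof unfold_locales
    show "t \<in> E\<inverse>" if "s \<in> E\<inverse>" "pair_iso (op_cat C) s t" for s t
      using ses_iso pair_iso_op that by (metis swap)
    show "r \<in> E\<inverse>" if "s \<in> E\<inverse>" "t \<in> E\<inverse>" "pair_direct_sum (op_cat C) s t r" for s t r
      using ses_direct_sum pair_direct_sum_op that by (metis swap)
    show "s \<in> E\<inverse> \<and> t \<in> E\<inverse>" if "r \<in> E\<inverse>" "pair_direct_sum (op_cat C) s t r" for s t r
      using ses_summand pair_direct_sum_op that by (metis swap)
    show "is_kernel (op_cat C) f g" if "(f, g) \<in> E\<inverse>" for f g
      using ses_cokernel that by simp
    show "is_cokernel (op_cat C) g f" if "(f, g) \<in> E\<inverse>" for f g
      using ses_kernel that by simp
    show "adm_mono (E\<inverse>) (Idn (op_cat C) X)" "adm_epi (E\<inverse>) (Idn (op_cat C) X)"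
      if "X \<in> Obj (op_cat C)" for X
      using id_adm_epi id_adm_mono that by simp_all
    show "adm_mono (E\<inverse>) (g \<cdot>\<^bsub>op_cat C\<^esub> f)"
      if "adm_mono (E\<inverse>) f" "adm_mono (E\<inverse>) g" "Cod (op_cat C) f = Dom (op_cat C) g" for f g
      using comp_adm_epi[of g f] that by simp
    show "adm_epi (E\<inverse>) (g \<cdot>\<^bsub>op_cat C\<^esub> f)"
      if "adm_epi (E\<inverse>) f" "adm_epi (E\<inverse>) g" "Cod (op_cat C) f = Dom (op_cat C) g" for f g
      using comp_adm_mono[of g f] that by simp
    show "\<exists>f' g'. pushout (op_cat C) f g f' g' \<and> adm_mono (E\<inverse>) f'"
      if "adm_mono (E\<inverse>) f" "g \<in> Arr (op_cat C)" "Dom (op_cat C) g = Dom (op_cat C) f" for f g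
      using pullback_adm_epi that by simp
    show "\<exists>f' g'. pullback (op_cat C) f g f' g' \<and> adm_epi (E\<inverse>) f'"
      if "adm_epi (E\<inverse>) f" "g \<in> Arr (op_cat C)" "Cod (op_cat C) g = Cod (op_cat C) f" for f g
      using pushout_adm_mono that by simp
  qed
qed

section \<open>The quotient of an additive category by an additive subcategory\<close>

lemma factors_through_op: "factors_through (op_cat C) W f \<longleftrightarrow> factors_through C W f"
  by (auto simp: factors_through_def)

lemma residue_class_op: "residue_class (op_cat C) W = residue_class C W"
  by (rule ext) (simp add: residue_class_def factors_through_op)

lemma quotient_cat_op: "quotient_cat (op_cat C) W = op_cat (quotient_cat C W)"
  unfolding quotient_cat_def residue_class_op op_cat_simps
  by (simp add: op_cat_def[of "\<lparr>Obj = _, Arr = _, Dom = _, Cod = _, Idn = _, Comp = _, Zero = _, Add = _\<rparr>"])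

locale additive_quotient = additive_category +
  fixes W :: "'a set"
  assumes W_obj: "W \<subseteq> Obj C"
    and W_nonempty: "W \<noteq> {}"
    and W_biproduct: "\<lbrakk>X \<in> W; Y \<in> W\<rbrakk> \<Longrightarrow> \<exists>Z\<in>W. \<exists>i j p q. biproduct C X Y Z i j p q"
begin

abbreviation "negligible \<equiv> factors_through C W"

lemma negligibleI:
  assumes "a \<in> Arr C" "b \<in> Arr C" "Cod C a = Dom C b" "Dom C b \<in> W"
  shows "negligible (b \<cdot> a)"
  using assms unfolding factors_through_def in_Hom
  by (intro bexI[of _ "Dom C b"] bexI[of _ a] bexI[of _ b]) (auto simp: in_Hom)

lemma negligibleE:
  assumes "negligible f"
  obtains a b where "a \<in> Arr C" "b \<in> Arr C" "Cod C a = Dom C b" "Dom C b \<in> W"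
    "Dom C f = Dom C a" "Cod C f = Cod C b" "f = b \<cdot> a"
  using assms by (auto simp: factors_through_def in_Hom)

lemma negligible_arr: "negligible f \<Longrightarrow> f \<in> Arr C"
  by (auto elim: negligibleE)

lemma negligible_comp:
  assumes "negligible f" "g \<in> Arr C"
  shows "Cod C f = Dom C g \<Longrightarrow> negligible (g \<cdot> f)" "Cod C g = Dom C f \<Longrightarrow> negligible (f \<cdot> g)"
proof -
  obtain a b where ab: "a \<in> Arr C" "b \<in> Arr C" "Cod C a = Dom C b" "Dom C b \<in> W"
    "Dom C f = Dom C a" "Cod C f = Cod C b" "f = b \<cdot> a" using assms(1) by (rule negligibleE)
  show "Cod C f = Dom C g \<Longrightarrow> negligible (g \<cdot> f)"
    using negligibleI[of a "g \<cdot> b"] ab assms(2) by (simp add: assoc)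
  show "Cod C g = Dom C f \<Longrightarrow> negligible (f \<cdot> g)"
    using negligibleI[of "a \<cdot> g" b] ab assms(2) by (simp add: assoc)
qed

lemma negligible_zero:
  assumes "X \<in> Obj C" "Y \<in> Obj C"
  shows "negligible (Zero C X Y)"
proof -
  obtain Z where "Z \<in> W" using W_nonempty by auto
  then show ?thesis
    using negligibleI[of "Zero C X Z" "Zero C Z Y"] W_obj assms by auto
qed

text \<open>Two factorizations combine into one through the direct sum of their middle objects.\<close>

lemma negligible_add:
  assumes "negligible f" "negligible g" "Dom C f = Dom C g" "Cod C f = Cod C g"
  shows "negligible (f \<boxplus> g)"
proof -
  obtain a b where ab: "a \<in> Arr C" "b \<in> Arr C" "Cod C a = Dom C b" "Dom C b \<in> W"
    "Dom C f = Dom C a" "Cod C f = Cod C b" "f = b \<cdot> a" using assms(1) by (rule negligibleE)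
  obtain a' b' where ab': "a' \<in> Arr C" "b' \<in> Arr C" "Cod C a' = Dom C b'" "Dom C b' \<in> W"
    "Dom C g = Dom C a'" "Cod C g = Cod C b'" "g = b' \<cdot> a'" using assms(2) by (rule negligibleE)
  obtain Z i j p q where Z: "Z \<in> W" "biproduct C (Dom C b) (Dom C b') Z i j p q"
    using W_biproduct[of "Dom C b" "Dom C b'"] ab ab' by blast
  note Z' = Z(2)[unfolded biproduct_def in_Hom]
  have e: "p \<cdot> i = Idn C (Dom C b)" "q \<cdot> j = Idn C (Dom C b')" "q \<cdot> i = Zero C (Dom C b) (Dom C b')"
    "p \<cdot> j = Zero C (Dom C b') (Dom C b)" using Z' by auto
  have "negligible ((b \<cdot> p \<boxplus> b' \<cdot> q) \<cdot> (i \<cdot> a \<boxplus> j \<cdot> a'))"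
    using Z Z' ab ab' assms by (intro negligibleI) auto
  moreover have "(b \<cdot> p \<boxplus> b' \<cdot> q) \<cdot> (i \<cdot> a \<boxplus> j \<cdot> a') = f \<boxplus> g"
    using Z' ab ab' assms by (simp add: assoc e[THEN reassoc])
  ultimately show ?thesis by simp
qed

lemma negligible_neg:
  assumes "negligible f"
  obtains n where "negligible n" "Dom C n = Dom C f" "Cod C n = Cod C f"
    "f \<boxplus> n = Zero C (Dom C f) (Cod C f)"
proof -
  obtain a b where ab: "a \<in> Arr C" "b \<in> Arr C" "Cod C a = Dom C b" "Dom C b \<in> W"
    "Dom C f = Dom C a" "Cod C f = Cod C b" "f = b \<cdot> a" using assms(1) by (rule negligibleE)
  obtain d where d: "d \<in> Arr C" "Dom C d = Dom C b" "Cod C d = Cod C b"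
    "Zero C (Dom C b) (Cod C b) = b \<boxplus> d"
    by (rule ex_diff[of "Zero C (Dom C b) (Cod C b)" b]) (use ab in auto)
  have "f \<boxplus> d \<cdot> a = (b \<boxplus> d) \<cdot> a" using ab d(1-3) by simp
  also have "\<dots> = Zero C (Dom C b) (Cod C b) \<cdot> a" by (simp only: d(4))
  also have "\<dots> = Zero C (Dom C f) (Cod C f)" using ab by simp
  finally show ?thesis using ab d(1-3) by (intro that[of "d \<cdot> a"] negligibleI) auto
qed

definition congruent :: "'b \<Rightarrow> 'b \<Rightarrow> bool" where
  "congruent f g \<longleftrightarrow> f \<in> Arr C \<and> g \<in> Arr C \<and> Dom C f = Dom C g \<and> Cod C f = Cod C g \<and>
    (\<exists>h. negligible h \<and> Dom C h = Dom C g \<and> Cod C h = Cod C g \<and> f = g \<boxplus> h)"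

lemma congruentI:
  assumes "g \<in> Arr C" "negligible h" "Dom C h = Dom C g" "Cod C h = Cod C g"
  shows "congruent (g \<boxplus> h) g"
  using assms negligible_arr[of h] unfolding congruent_def by (auto intro!: exI[of _ h])

lemma congruent_refl: "f \<in> Arr C \<Longrightarrow> congruent f f"
  unfolding congruent_def by (auto intro!: exI[of _ "Zero C (Dom C f) (Cod C f)"] negligible_zero)

lemma congruent_sym:
  assumes "congruent f g"
  shows "congruent g f"
proof -
  obtain h where h: "negligible h" "Dom C h = Dom C g" "Cod C h = Cod C g" "f = g \<boxplus> h"
    "g \<in> Arr C" using assms by (auto simp: congruent_def)
  obtain n where n: "negligible n" "Dom C n = Dom C h" "Cod C n = Cod C h"
    "h \<boxplus> n = Zero C (Dom C h) (Cod C h)" using h(1) by (rule negligible_neg)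
  have "f \<boxplus> n = g" using h n negligible_arr by (simp add: add_assoc)
  then show ?thesis using h n negligible_arr unfolding congruent_def by (auto intro!: exI[of _ n])
qed

lemma congruent_trans:
  assumes "congruent f g" "congruent g k"
  shows "congruent f k"
proof -
  obtain h where h: "negligible h" "Dom C h = Dom C g" "Cod C h = Cod C g" "f = g \<boxplus> h"
    "g \<in> Arr C" using assms by (auto simp: congruent_def)
  obtain h' where h': "negligible h'" "Dom C h' = Dom C k" "Cod C h' = Cod C k" "g = k \<boxplus> h'"
    "k \<in> Arr C" using assms by (auto simp: congruent_def)
  have a: "h \<in> Arr C" "h' \<in> Arr C" using h h' negligible_arr by auto
  then have e: "f = k \<boxplus> (h' \<boxplus> h)" using h h' by (simp add: add_assoc)
  have "negligible (h' \<boxplus> h)"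
    by (intro negligible_add) (use a h h' in simp_all)
  then show ?thesis unfolding e by (rule congruentI[rotated]) (use a h h' in simp_all)
qed

lemma congruent_add:
  assumes "congruent f f'" "congruent g g'" "Dom C f = Dom C g" "Cod C f = Cod C g"
  shows "congruent (f \<boxplus> g) (f' \<boxplus> g')"
proof -
  obtain h where h: "negligible h" "Dom C h = Dom C f'" "Cod C h = Cod C f'" "f = f' \<boxplus> h"
    "f' \<in> Arr C" "h \<in> Arr C" using assms(1) by (auto simp: congruent_def negligible_arr)
  obtain k where k: "negligible k" "Dom C k = Dom C g'" "Cod C k = Cod C g'" "g = g' \<boxplus> k"
    "g' \<in> Arr C" "k \<in> Arr C" using assms(2) by (auto simp: congruent_def negligible_arr)
  have d: "Dom C f' = Dom C g'" "Cod C f' = Cod C g'" using assms h k by auto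
  have "f \<boxplus> g = f' \<boxplus> (h \<boxplus> (g' \<boxplus> k))" using h k d by (simp add: add_assoc)
  also have "h \<boxplus> (g' \<boxplus> k) = (h \<boxplus> g') \<boxplus> k" using h k d by (simp add: add_assoc)
  also have "h \<boxplus> g' = g' \<boxplus> h" using h k d by (simp add: add_comm)
  finally have e: "f \<boxplus> g = (f' \<boxplus> g') \<boxplus> (h \<boxplus> k)" using h k d by (simp add: add_assoc)
  have "negligible (h \<boxplus> k)"
    by (intro negligible_add) (use h k d in simp_all)
  then show ?thesis unfolding e by (rule congruentI[rotated]) (use h k d in simp_all)
qed

lemma congruent_comp:
  assumes "congruent f f'" "congruent g g'" "Cod C f = Dom C g"
  shows "congruent (g \<cdot> f) (g' \<cdot> f')"
proof -
  obtain h where h: "negligible h" "Dom C h = Dom C f'" "Cod C h = Cod C f'" "f = f' \<boxplus> h"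
    "f' \<in> Arr C" "h \<in> Arr C" using assms(1) by (auto simp: congruent_def negligible_arr)
  obtain k where k: "negligible k" "Dom C k = Dom C g'" "Cod C k = Cod C g'" "g = g' \<boxplus> k"
    "g' \<in> Arr C" "k \<in> Arr C" using assms(2) by (auto simp: congruent_def negligible_arr)
  have d: "Cod C f' = Dom C g'" using assms h k by auto
  have f: "f \<in> Arr C" "Dom C f = Dom C f'" "Cod C f = Cod C f'" using h by auto
  have "g \<cdot> f = g' \<cdot> f \<boxplus> k \<cdot> f" using f k d by simp
  also have "g' \<cdot> f = g' \<cdot> f' \<boxplus> g' \<cdot> h" using h k d by simp
  finally have e: "g \<cdot> f = g' \<cdot> f' \<boxplus> (g' \<cdot> h \<boxplus> k \<cdot> f)" using h k d f by (simp add: add_assoc)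
  have "negligible (g' \<cdot> h \<boxplus> k \<cdot> f)"
    by (intro negligible_add negligible_comp) (use h k d f in simp_all)
  then show ?thesis unfolding e by (rule congruentI[rotated]) (use h k d f in simp_all)
qed

lemma congruent_zero_iff:
  assumes "f \<in> Arr C"
  shows "congruent f (Zero C (Dom C f) (Cod C f)) \<longleftrightarrow> negligible f"
proof
  assume "congruent f (Zero C (Dom C f) (Cod C f))"
  then show "negligible f" using assms negligible_arr by (auto simp: congruent_def)
next
  assume "negligible f"
  then show "congruent f (Zero C (Dom C f) (Cod C f))"
    using assms by (auto simp: congruent_def intro!: exI[of _ f])
qed

abbreviation "cls \<equiv> residue_class C W"
abbreviation "Q \<equiv> quotient_cat C W"

lemma cls_eq_congruent: "f \<in> Arr C \<Longrightarrow> cls f = {g. congruent g f}"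
  by (auto simp: residue_class_def congruent_def in_Hom negligible_arr)

lemma cls_eq_iff:
  assumes "f \<in> Arr C" "g \<in> Arr C"
  shows "cls f = cls g \<longleftrightarrow> congruent f g"
  unfolding cls_eq_congruent[OF assms(1)] cls_eq_congruent[OF assms(2)]
  using congruent_refl[OF assms(1)] congruent_sym congruent_trans by blast

lemma representative_cls: "f \<in> Arr C \<Longrightarrow> congruent (representative (cls f)) f"
  unfolding representative_def cls_eq_congruent
  by (rule someI2[of _ f]) (auto intro: congruent_refl)

lemma Q_simps [simp]:
  "Obj Q = Obj C" "Arr Q = cls ` Arr C" "Idn Q X = cls (Idn C X)" "Zero Q X Y = cls (Zero C X Y)"
  "f \<in> Arr C \<Longrightarrow> Dom Q (cls f) = Dom C f" "f \<in> Arr C \<Longrightarrow> Cod Q (cls f) = Cod C f"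
  using representative_cls by (auto simp: quotient_cat_def congruent_def)

lemma Q_comp [simp]:
  assumes "f \<in> Arr C" "g \<in> Arr C" "Cod C f = Dom C g"
  shows "cls g \<cdot>\<^bsub>Q\<^esub> cls f = cls (g \<cdot> f)"
proof -
  have r: "congruent (representative (cls f)) f" "congruent (representative (cls g)) g"
    using assms by (auto intro: representative_cls)
  then have "congruent (representative (cls g) \<cdot> representative (cls f)) (g \<cdot> f)"
    using assms by (intro congruent_comp) (auto simp: congruent_def)
  then show ?thesis
    using assms by (simp add: quotient_cat_def cls_eq_iff congruent_def)
qed

lemma Q_add [simp]:
  assumes "f \<in> Arr C" "g \<in> Arr C" "Dom C f = Dom C g" "Cod C f = Cod C g"
  shows "cls f \<boxplus>\<^bsub>Q\<^esub> cls g = cls (f \<boxplus> g)"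
proof -
  have r: "congruent (representative (cls f)) f" "congruent (representative (cls g)) g"
    using assms by (auto intro: representative_cls)
  then have "congruent (representative (cls f) \<boxplus> representative (cls g)) (f \<boxplus> g)"
    using assms by (intro congruent_add) (auto simp: congruent_def)
  then show ?thesis
    using assms by (simp add: quotient_cat_def cls_eq_iff congruent_def)
qed

lemma Q_Hom: "Hom Q X Y = cls ` Hom C X Y"
  unfolding Hom_def by fastforce

lemma quotient_preadditive: "preadditive_category Q"
proof (intro preadditive_category.intro preadditive_category_axioms.intro)
  show "category Q"
    by unfold_locales (auto simp: Q_Hom in_Hom assoc)
  show "comm_group (Hom_group Q X Y)" if "X \<in> Obj Q" "Y \<in> Obj Q" for X Y
  proof (rule comm_groupI)
    fix F assume "F \<in> carrier (Hom_group Q X Y)"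
    then obtain f where f: "f \<in> Arr C" "Dom C f = X" "Cod C f = Y" "F = cls f"
      by (auto simp: Hom_group_def Q_Hom in_Hom)
    obtain d where d: "d \<in> Arr C" "Dom C d = Dom C f" "Cod C d = Cod C f" "Zero C X Y = f \<boxplus> d"
      by (rule ex_diff[of "Zero C X Y" f]) (use f in auto)
    then have "d \<boxplus> f = Zero C X Y" using f by (simp add: add_comm)
    with d show "\<exists>G\<in>carrier (Hom_group Q X Y). G \<otimes>\<^bsub>Hom_group Q X Y\<^esub> F = \<one>\<^bsub>Hom_group Q X Y\<^esub>"
      using f by (intro bexI[of _ "cls d"]) (auto simp: Hom_group_def Q_Hom in_Hom)
  next
    fix F G assume "F \<in> carrier (Hom_group Q X Y)" "G \<in> carrier (Hom_group Q X Y)"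
    then show "F \<otimes>\<^bsub>Hom_group Q X Y\<^esub> G = G \<otimes>\<^bsub>Hom_group Q X Y\<^esub> F"
      by (auto simp: Hom_group_def Q_Hom in_Hom add_comm)
  qed (use that in \<open>auto simp: Hom_group_def Q_Hom in_Hom add_assoc\<close>)
qed (auto simp: Q_Hom in_Hom)

lemma quotient_additive: "additive_category Q"
proof (intro additive_category.intro quotient_preadditive additive_category_axioms.intro)
  obtain Z where Z: "zero_object C Z" using ex_zero_object by auto
  have singleton: "(\<exists>!f. f \<in> A) \<longleftrightarrow> (\<exists>f. A = {f})" for A :: "'x set"
    by auto
  have "\<exists>!F. F \<in> Hom Q X Z" "\<exists>!F. F \<in> Hom Q Z X" if "X \<in> Obj C" for X
    using Z that unfolding zero_object_def Q_Hom singleton by force+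
  then have "zero_object Q Z" using Z by (simp add: zero_object_def)
  then show "\<exists>Z. zero_object Q Z" by blast
  fix X Y assume "X \<in> Obj Q" "Y \<in> Obj Q"
  then obtain Z i j p q where "biproduct C X Y Z i j p q" using ex_biproduct[of X Y] by auto
  then have "biproduct Q X Y Z (cls i) (cls j) (cls p) (cls q)"
    by (auto simp: biproduct_def Q_Hom in_Hom)
  then show "\<exists>Z i j p q. biproduct Q X Y Z i j p q" by blast
qed

text \<open>A criterion in terms of representatives. Factorizations are demanded on the nose, which is the
  form in which pushouts provide them; uniqueness in the quotient becomes, by taking differences,
  the condition that composition with \<open>c\<close> detects negligibility.\<close>

lemma quotient_cokernel:
  assumes f: "f \<in> Arr C" and c: "c \<in> Arr C" "Dom C c = Cod C f" "negligible (c \<cdot> f)"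
    and factor: "\<And>g. \<lbrakk>g \<in> Arr C; Dom C g = Cod C f; negligible (g \<cdot> f)\<rbrakk>
      \<Longrightarrow> \<exists>u\<in>Hom C (Cod C c) (Cod C g). u \<cdot> c = g"
    and unique: "\<And>u. \<lbrakk>u \<in> Arr C; Dom C u = Cod C c; negligible (u \<cdot> c)\<rbrakk> \<Longrightarrow> negligible u"
  shows "is_cokernel Q (cls c) (cls f)"
proof -
  have zero: "cls g = cls (Zero C (Dom C g) (Cod C g)) \<longleftrightarrow> negligible g" if "g \<in> Arr C" for g
    using that by (simp add: cls_eq_iff congruent_zero_iff)
  have "\<exists>!U. U \<in> Hom Q (Cod C c) X \<and> U \<cdot>\<^bsub>Q\<^esub> cls c = G"
    if "X \<in> Obj C" and G: "G \<in> Hom Q (Cod C f) X" "G \<cdot>\<^bsub>Q\<^esub> cls f = cls (Zero C (Dom C f) X)" for X G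
  proof -
    obtain g where g: "g \<in> Arr C" "Dom C g = Cod C f" "Cod C g = X" "G = cls g"
      using G(1) by (auto simp: Q_Hom in_Hom)
    then have gf: "negligible (g \<cdot> f)" using G(2) f zero[of "g \<cdot> f"] by simp
    obtain u where "u \<in> Hom C (Cod C c) (Cod C g)" "u \<cdot> c = g"
      using factor[OF g(1,2) gf] by (rule bexE)
    then have u: "u \<in> Arr C" "Dom C u = Cod C c" "Cod C u = X" "u \<cdot> c = g"
      using g by (auto simp: in_Hom)
    show ?thesis
    proof (rule ex1I[of _ "cls u"])
      show "cls u \<in> Hom Q (Cod C c) X \<and> cls u \<cdot>\<^bsub>Q\<^esub> cls c = G"
        using u c g by (auto simp: Q_Hom in_Hom)
      fix U assume U: "U \<in> Hom Q (Cod C c) X \<and> U \<cdot>\<^bsub>Q\<^esub> cls c = G"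
      then obtain v where v: "v \<in> Arr C" "Dom C v = Cod C c" "Cod C v = X" "U = cls v"
        by (auto simp: Q_Hom in_Hom)
      obtain d where "d \<in> Arr C" "Dom C d = Dom C u" "Cod C d = Cod C u" "v = u \<boxplus> d"
        by (rule ex_diff[of v u]) (use u v in auto)
      then have d: "d \<in> Arr C" "Dom C d = Cod C c" "Cod C d = X" "v = u \<boxplus> d"
        using u by auto
      have "congruent (v \<cdot> c) (u \<cdot> c)" using U v u c g by (simp flip: cls_eq_iff)
      then obtain h where h: "negligible h" "Dom C h = Dom C c" "Cod C h = X" "v \<cdot> c = u \<cdot> c \<boxplus> h"
        using u c by (auto simp: congruent_def)
      \<comment> \<open>the difference of two factorizations becomes negligible after composing with \<open>c\<close>\<close>
      have "u \<cdot> c \<boxplus> d \<cdot> c = u \<cdot> c \<boxplus> h" using h(4) u(1-3) c d by simp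
      then have "d \<cdot> c = h"
        by (rule add_cancel[rotated -1]) (use u(1-3) c d(1-3) h(1-3) negligible_arr[OF h(1)] in simp_all)
      then have "negligible d" using unique[OF d(1,2)] h(1) by simp
      then have "congruent v u" unfolding d(4) by (rule congruentI[rotated]) (use u(1-3) d(1-3) in simp_all)
      then show "U = cls u" using u v by (simp add: cls_eq_iff)
    qed
  qed
  moreover have "cls c \<cdot>\<^bsub>Q\<^esub> cls f = cls (Zero C (Dom C f) (Cod C c))"
    using zero[of "c \<cdot> f"] c f by simp
  ultimately show ?thesis using c f by (simp add: is_cokernel_def)
qed

end

section \<open>Full subcategories\<close>

lemma full_sub_simps [simp]:
  "Obj (full_sub C A) = A" "Arr (full_sub C A) = {f \<in> Arr C. Dom C f \<in> A \<and> Cod C f \<in> A}"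
  "Dom (full_sub C A) = Dom C" "Cod (full_sub C A) = Cod C" "Idn (full_sub C A) = Idn C"
  "Comp (full_sub C A) = Comp C" "Zero (full_sub C A) = Zero C" "Add (full_sub C A) = Add C"
  by (simp_all add: full_sub_def)

lemma Hom_full_sub: "Hom (full_sub C A) X Y = (if X \<in> A \<and> Y \<in> A then Hom C X Y else {})"
  by (auto simp: Hom_def)

lemma full_sub_op: "full_sub (op_cat C) A = op_cat (full_sub C A)"
  by (auto simp: full_sub_def op_cat_def)

lemma biproduct_full_sub:
  "\<lbrakk>A \<subseteq> Obj C; X \<in> A; Y \<in> A; Z \<in> A\<rbrakk>
    \<Longrightarrow> biproduct (full_sub C A) X Y Z i j p q \<longleftrightarrow> biproduct C X Y Z i j p q"
  by (auto simp: biproduct_def Hom_full_sub)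

lemma factors_through_full_sub:
  assumes "W \<subseteq> A" "Dom C f \<in> A" "Cod C f \<in> A"
  shows "factors_through (full_sub C A) W f \<longleftrightarrow> factors_through C W f"
  using assms by (auto simp: factors_through_def Hom_full_sub)

lemma (in additive_category) additive_full_sub:
  assumes A: "A \<subseteq> Obj C" and zero: "\<And>Z. zero_object C Z \<Longrightarrow> Z \<in> A"
    and bip: "\<And>X Y Z i j p q. \<lbrakk>X \<in> A; Y \<in> A; biproduct C X Y Z i j p q\<rbrakk> \<Longrightarrow> Z \<in> A"
  shows "additive_category (full_sub C A)"
proof (intro additive_category.intro preadditive_category.intro preadditive_category_axioms.intro
    additive_category_axioms.intro)
  show "category (full_sub C A)"
    using A by unfold_locales (auto simp: in_Hom assoc)
  show "comm_group (Hom_group (full_sub C A) X Y)"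
    if "X \<in> Obj (full_sub C A)" "Y \<in> Obj (full_sub C A)" for X Y
  proof -
    have "Hom_group (full_sub C A) X Y = Hom_group C X Y"
      using that by (simp add: Hom_group_def Hom_full_sub)
    then show ?thesis using hom_group[of X Y] that A by auto
  qed
  obtain Z where Z: "zero_object C Z" using ex_zero_object by blast
  then have "zero_object (full_sub C A) Z"
    using zero[OF Z] A by (auto simp: zero_object_def Hom_full_sub subset_iff)
  then show "\<exists>Z. zero_object (full_sub C A) Z" by blast
  show "\<exists>Z i j p q. biproduct (full_sub C A) X Y Z i j p q"
    if XY: "X \<in> Obj (full_sub C A)" "Y \<in> Obj (full_sub C A)" for X Y
  proof -
    obtain Z i j p q where Z: "biproduct C X Y Z i j p q"
      using ex_biproduct[of X Y] XY A unfolding full_sub_simps by blast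
    have XY': "X \<in> A" "Y \<in> A" using XY by simp_all
    then have "biproduct (full_sub C A) X Y Z i j p q"
      using biproduct_full_sub[OF A XY' bip[OF XY' Z]] Z by blast
    then show ?thesis by blast
  qed
qed (auto simp: in_Hom)

section \<open>Short exact sequences\<close>

lemma (in preadditive_category) is_cokernelI:
  assumes "c \<in> Arr C" "f \<in> Arr C" "Dom C c = Cod C f" "c \<cdot> f = Zero C (Dom C f) (Cod C c)"
    and "\<And>h. \<lbrakk>h \<in> Arr C; Dom C h = Cod C f; h \<cdot> f = Zero C (Dom C f) (Cod C h)\<rbrakk>
      \<Longrightarrow> \<exists>u\<in>Arr C. Dom C u = Cod C c \<and> Cod C u = Cod C h \<and> u \<cdot> c = h"
    and "\<And>u v. \<lbrakk>u \<in> Arr C; v \<in> Arr C; Dom C u = Cod C c; Dom C v = Cod C c; Cod C u = Cod C v;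
      u \<cdot> c = v \<cdot> c\<rbrakk> \<Longrightarrow> u = v"
  shows "is_cokernel C c f"
  unfolding is_cokernel_def
proof (intro conjI assms(1-4) ballI impI)
  fix X h assume h: "h \<in> Hom C (Cod C f) X" "h \<cdot> f = Zero C (Dom C f) X"
  then obtain u where u: "u \<in> Arr C" "Dom C u = Cod C c" "Cod C u = X" "u \<cdot> c = h"
    using assms(5)[of h] by (auto simp: in_Hom)
  show "\<exists>!u. u \<in> Hom C (Cod C c) X \<and> u \<cdot> c = h"
  proof (rule ex1I[of _ u])
    show "u \<in> Hom C (Cod C c) X \<and> u \<cdot> c = h" using u by (simp add: in_Hom)
    fix v assume "v \<in> Hom C (Cod C c) X \<and> v \<cdot> c = h"
    then have v: "v \<in> Arr C" "Dom C v = Cod C c" "Cod C v = X" "v \<cdot> c = h"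
      by (simp_all add: in_Hom)
    show "v = u" by (rule assms(6)) (use u v in simp_all)
  qed
qed

lemma is_cokernelE:
  assumes "is_cokernel C c f" "h \<in> Arr C" "Dom C h = Cod C f"
    "h \<cdot>\<^bsub>C\<^esub> f = Zero C (Dom C f) (Cod C h)" "Cod C h \<in> Obj C"
  obtains u where "u \<in> Arr C" "Dom C u = Cod C c" "Cod C u = Cod C h" "u \<cdot>\<^bsub>C\<^esub> c = h"
proof -
  have "\<exists>!u. u \<in> Hom C (Cod C c) (Cod C h) \<and> u \<cdot>\<^bsub>C\<^esub> c = h"
    using assms by (simp add: is_cokernel_def in_Hom)
  then obtain u where "u \<in> Hom C (Cod C c) (Cod C h)" "u \<cdot>\<^bsub>C\<^esub> c = h" by blast
  then show ?thesis by (intro that) (auto simp: in_Hom)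
qed

lemma (in preadditive_category) is_cokernel_epi:
  assumes "is_cokernel C c f" "u \<in> Arr C" "v \<in> Arr C" "Dom C u = Cod C c" "Dom C v = Cod C c"
    "Cod C u = Cod C v" "u \<cdot> c = v \<cdot> c"
  shows "u = v"
proof -
  have c: "c \<in> Arr C" "f \<in> Arr C" "Dom C c = Cod C f" "c \<cdot> f = Zero C (Dom C f) (Cod C c)"
    using assms(1) by (auto simp: is_cokernel_def)
  have "(v \<cdot> c) \<cdot> f = Zero C (Dom C f) (Cod C v)" using c assms(2-6) by (simp add: assoc)
  then have "\<exists>!u. u \<in> Hom C (Cod C c) (Cod C v) \<and> u \<cdot> c = v \<cdot> c"
    using assms(1-6) c by (simp add: is_cokernel_def in_Hom)
  then show ?thesis using assms(2-7) by (auto simp: in_Hom)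
qed

lemma pushoutD:
  assumes "pushout C f g f' g'"
  shows "f \<in> Arr C" "g \<in> Arr C" "f' \<in> Arr C" "g' \<in> Arr C"
    "Dom C f' = Cod C g" "Dom C g' = Cod C f" "Cod C f' = Cod C g'"
    "f' \<cdot>\<^bsub>C\<^esub> g = g' \<cdot>\<^bsub>C\<^esub> f"
  using assms by (auto simp: pushout_def)

lemma pushout_swap:
  assumes po: "pushout C f g f' g'"
  shows "pushout C g f g' f'"
proof -
  have "\<exists>!u. u \<in> Hom C (Cod C g') X \<and> u \<cdot>\<^bsub>C\<^esub> g' = a \<and> u \<cdot>\<^bsub>C\<^esub> f' = b"
    if X: "X \<in> Obj C" and ab: "a \<in> Hom C (Cod C f) X" "b \<in> Hom C (Cod C g) X"
      and e: "a \<cdot>\<^bsub>C\<^esub> f = b \<cdot>\<^bsub>C\<^esub> g"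
    for X a b
  proof -
    have "\<exists>!u. u \<in> Hom C (Cod C f') X \<and> u \<cdot>\<^bsub>C\<^esub> f' = b \<and> u \<cdot>\<^bsub>C\<^esub> g' = a"
      using po X ab e[symmetric] unfolding pushout_def by blast
    moreover have "Cod C f' = Cod C g'" using po by (simp add: pushout_def)
    ultimately show ?thesis by (simp add: conj_ac)
  qed
  then show ?thesis using po by (simp add: pushout_def)
qed

lemma pushoutE:
  assumes "pushout C f g f' g'" "a \<in> Arr C" "b \<in> Arr C" "Dom C a = Cod C g" "Dom C b = Cod C f"
    "Cod C a = Cod C b" "Cod C b \<in> Obj C" "a \<cdot>\<^bsub>C\<^esub> g = b \<cdot>\<^bsub>C\<^esub> f"
  obtains u where "u \<in> Arr C" "Dom C u = Cod C g'" "Cod C u = Cod C b" "u \<cdot>\<^bsub>C\<^esub> f' = a"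
    "u \<cdot>\<^bsub>C\<^esub> g' = b"
proof -
  have "\<exists>!u. u \<in> Hom C (Cod C f') (Cod C b) \<and> u \<cdot>\<^bsub>C\<^esub> f' = a \<and> u \<cdot>\<^bsub>C\<^esub> g' = b"
  proof -
    have "a \<in> Hom C (Cod C g) (Cod C b)" "b \<in> Hom C (Cod C f) (Cod C b)"
      using assms by (simp_all add: in_Hom)
    then show ?thesis using assms(1,7,8) unfolding pushout_def by blast
  qed
  then obtain u where "u \<in> Hom C (Cod C f') (Cod C b)" "u \<cdot>\<^bsub>C\<^esub> f' = a" "u \<cdot>\<^bsub>C\<^esub> g' = b" by blast
  then show ?thesis using assms(1) by (intro that[of u]) (auto simp: in_Hom pushout_def)
qed

lemma (in category) pushout_unique:
  assumes "pushout C f g f' g'" "u \<in> Arr C" "v \<in> Arr C" "Dom C u = Cod C g'" "Dom C v = Cod C g'"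
    "Cod C u = Cod C v" "u \<cdot> f' = v \<cdot> f'" "u \<cdot> g' = v \<cdot> g'"
  shows "u = v"
proof -
  note p = pushoutD[OF assms(1)]
  have "(v \<cdot> f') \<cdot> g = (v \<cdot> g') \<cdot> f"
    using p assms(1-6) by (simp add: assoc pushout_def)
  moreover have "\<exists>!w. w \<in> Hom C (Cod C f') (Cod C v) \<and> w \<cdot> f' = v \<cdot> f' \<and> w \<cdot> g' = v \<cdot> g'"
    if "(v \<cdot> f') \<cdot> g = (v \<cdot> g') \<cdot> f"
  proof -
    have "v \<cdot> f' \<in> Hom C (Cod C g) (Cod C v)" "v \<cdot> g' \<in> Hom C (Cod C f) (Cod C v)"
      using assms(2-6) p by (simp_all add: in_Hom)
    then show ?thesis using that assms(1) cod_obj[OF assms(3)] unfolding pushout_def by blast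
  qed
  ultimately have "\<exists>!w. w \<in> Hom C (Cod C f') (Cod C v) \<and> w \<cdot> f' = v \<cdot> f' \<and> w \<cdot> g' = v \<cdot> g'"
    by blast
  then show ?thesis using assms(2-8) p(7) by (auto simp: in_Hom)
qed

lemma (in additive_category) zero_objectI:
  assumes Z: "Z \<in> Obj C" and id: "Idn C Z = Zero C Z Z"
  shows "zero_object C Z"
  unfolding zero_object_def
proof (intro conjI Z ballI)
  fix X assume X: "X \<in> Obj C"
  have "f = Zero C X Z" if "f \<in> Hom C X Z" for f
  proof -
    have "f = Idn C Z \<cdot> f" using that by (simp add: in_Hom)
    also have "\<dots> = Zero C X Z" using that Z by (auto simp: in_Hom id)
    finally show ?thesis .
  qed
  then show "\<exists>!f. f \<in> Hom C X Z" using X Z by (intro ex1I[of _ "Zero C X Z"]) (auto simp: in_Hom)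
  have "f = Zero C Z X" if "f \<in> Hom C Z X" for f
  proof -
    have "f = f \<cdot> Idn C Z" using that by (simp add: in_Hom)
    also have "\<dots> = Zero C Z X" using that Z by (auto simp: in_Hom id)
    finally show ?thesis .
  qed
  then show "\<exists>!f. f \<in> Hom C Z X" using X Z by (intro ex1I[of _ "Zero C Z X"]) (auto simp: in_Hom)
qed

context exact_category
begin

lemma sesD:
  assumes "(f, g) \<in> E"
  shows "f \<in> Arr C" "g \<in> Arr C" "Cod C f = Dom C g" "g \<cdot> f = Zero C (Dom C f) (Cod C g)"
    "adm_mono E f" "adm_epi E g"
  using ses_kernel[OF assms] assms by (auto simp: is_kernel_def adm_mono_def adm_epi_def)

lemma ses_desc:
  assumes "(f, g) \<in> E" "h \<in> Arr C" "Dom C h = Dom C g" "h \<cdot> f = Zero C (Dom C f) (Cod C h)"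
  obtains u where "u \<in> Arr C" "Dom C u = Cod C g" "Cod C u = Cod C h" "u \<cdot> g = h"
  by (rule is_cokernelE[OF ses_cokernel[OF assms(1)], of h]) (use assms sesD[OF assms(1)] in auto)

lemma ses_epi:
  assumes "(f, g) \<in> E" "u \<in> Arr C" "v \<in> Arr C" "Dom C u = Cod C g" "Dom C v = Cod C g"
    "Cod C u = Cod C v" "u \<cdot> g = v \<cdot> g"
  shows "u = v"
  using is_cokernel_epi[OF ses_cokernel[OF assms(1)] assms(2-)] .

lemma ses_lift:
  assumes "(f, g) \<in> E" "h \<in> Arr C" "Cod C h = Dom C g" "g \<cdot> h = Zero C (Dom C h) (Cod C g)"
  obtains u where "u \<in> Arr C" "Cod C u = Dom C f" "Dom C u = Dom C h" "f \<cdot> u = h"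
proof -
  interpret op: exact_category "op_cat C" "E\<inverse>" by (rule exact_category_op)
  show ?thesis
    by (rule op.ses_desc[of g f h]) (use assms that sesD[OF assms(1)] in simp_all)
qed

lemma ses_mono:
  assumes "(f, g) \<in> E" "u \<in> Arr C" "v \<in> Arr C" "Cod C u = Dom C f" "Cod C v = Dom C f"
    "Dom C u = Dom C v" "f \<cdot> u = f \<cdot> v"
  shows "u = v"
proof -
  interpret op: exact_category "op_cat C" "E\<inverse>" by (rule exact_category_op)
  show ?thesis by (rule op.ses_epi[of g f]) (use assms in simp_all)
qed

text \<open>Two cokernels of \<open>f\<close> differ by an isomorphism, and short exact sequences are closed under
  isomorphism.\<close>

lemma ses_other_cokernel:
  assumes fg: "(f, g) \<in> E" and g': "is_cokernel C g' f"
  shows "(f, g') \<in> E"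
proof -
  note s = sesD[OF fg]
  have s': "g' \<in> Arr C" "Dom C g' = Dom C g" "g' \<cdot> f = Zero C (Dom C f) (Cod C g')"
    "Cod C f = Dom C g" using g' s by (auto simp: is_cokernel_def)
  obtain a where a: "a \<in> Arr C" "Dom C a = Cod C g" "Cod C a = Cod C g'" "a \<cdot> g = g'"
    by (rule ses_desc[OF fg, of g']) (use s' in simp_all)
  obtain b where b: "b \<in> Arr C" "Dom C b = Cod C g'" "Cod C b = Cod C g" "b \<cdot> g' = g"
    by (rule is_cokernelE[OF g', of g]) (use s in simp_all)
  have "b \<cdot> a = Idn C (Cod C g)"
    by (rule ses_epi[OF fg]) (use a b s s' in \<open>simp_all add: assoc\<close>)
  moreover have "a \<cdot> b = Idn C (Cod C g')"
    by (rule is_cokernel_epi[OF g']) (use a b s s' in \<open>simp_all add: assoc\<close>)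
  ultimately have "is_iso C a" using a b by (auto simp: is_iso_def in_Hom intro!: bexI[of _ b])
  moreover have "is_iso C (Idn C X)" if "X \<in> Obj C" for X
    using that by (auto simp: is_iso_def in_Hom intro!: bexI[of _ "Idn C X"])
  ultimately have "is_iso C (Idn C (Dom C f))" "is_iso C (Idn C (Cod C f))" "is_iso C a"
    using s by auto
  moreover have "Idn C (Dom C f) \<in> Hom C (Dom C f) (Dom C f)"
    "Idn C (Cod C f) \<in> Hom C (Cod C f) (Cod C f)" "a \<in> Hom C (Cod C g) (Cod C g')"
    "Idn C (Cod C f) \<cdot> f = f \<cdot> Idn C (Dom C f)" "a \<cdot> g = g' \<cdot> Idn C (Cod C f)"
    "composable_pair C (f, g)" "composable_pair C (f, g')"
    using s s' a by (simp_all add: in_Hom composable_pair_def)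
  ultimately have "pair_iso C (f, g) (f, g')"
    unfolding pair_iso_def fst_conv snd_conv by blast
  then show ?thesis using ses_iso fg by blast
qed

text \<open>The axioms provide one pushout along which an admissible monomorphism is preserved; since
  pushouts are unique up to isomorphism, every pushout preserves it.\<close>

lemma adm_mono_pushout:
  assumes po: "pushout C f a f' a'" and f: "adm_mono E f"
  shows "adm_mono E f'"
proof -
  note p = pushoutD[OF po]
  have da: "Dom C a = Dom C f" using po by (simp add: pushout_def)
  obtain k b where po': "pushout C f a k b" and k: "adm_mono E k"
    using pushout_adm_mono[OF f p(2) da] by blast
  note q = pushoutD[OF po']
  obtain g where kg: "(k, g) \<in> E" using k by (auto simp: adm_mono_def)
  note gD = sesD(1-4)[OF kg]
  obtain h where h: "h \<in> Arr C" "Dom C h = Cod C b" "Cod C h = Cod C a'" "h \<cdot> k = f'" "h \<cdot> b = a'"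
    by (rule pushoutE[OF po', of f' a']) (use p in simp_all)
  obtain h' where h': "h' \<in> Arr C" "Dom C h' = Cod C a'" "Cod C h' = Cod C b"
    "h' \<cdot> f' = k" "h' \<cdot> a' = b"
    by (rule pushoutE[OF po, of k b]) (use q in simp_all)
  have hh': "h \<cdot> h' = Idn C (Cod C a')"
    by (rule pushout_unique[OF po]) (use h h' p(1-7) in \<open>simp_all add: assoc\<close>)
  have h'h: "h' \<cdot> h = Idn C (Cod C b)"
    by (rule pushout_unique[OF po']) (use h h' q(1-7) in \<open>simp_all add: assoc\<close>)
  have iso_id: "is_iso C (Idn C X)" if "X \<in> Obj C" for X
    using that by (auto simp: is_iso_def in_Hom intro!: bexI[of _ "Idn C X"])
  have "is_iso C h" using h h' hh' h'h by (auto simp: is_iso_def in_Hom intro!: bexI[of _ h'])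
  moreover have "is_iso C (Idn C (Dom C k))" "is_iso C (Idn C (Cod C g))"
    using iso_id gD by simp_all
  moreover have "Idn C (Dom C k) \<in> Hom C (Dom C k) (Dom C f')" "h \<in> Hom C (Cod C k) (Cod C f')"
    "Idn C (Cod C g) \<in> Hom C (Cod C g) (Cod C (g \<cdot> h'))" "h \<cdot> k = f' \<cdot> Idn C (Dom C k)"
    "composable_pair C (k, g)" "composable_pair C (f', g \<cdot> h')"
    using gD h h' p(1-7) q(1-7) by (simp_all add: in_Hom composable_pair_def)
  moreover have "Idn C (Cod C g) \<cdot> g = (g \<cdot> h') \<cdot> h"
    using gD h h' h'h q(1-7) by (simp add: assoc)
  ultimately have "pair_iso C (k, g) (f', g \<cdot> h')"
    unfolding pair_iso_def fst_conv snd_conv by blast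
  then show ?thesis using ses_iso kg unfolding adm_mono_def by blast
qed

text \<open>On the pushout, \<open>g\<close> and the zero morphism induce \<open>g'\<close>, and the universal properties make it the
  cokernel of \<open>f'\<close>.\<close>

lemma ses_pushout:
  assumes fg: "(f, g) \<in> E" and p: "pushout C f a f' a'"
  obtains g' where "(f', g') \<in> E" "Cod C g' = Cod C g" "g' \<cdot> a' = g"
proof -
  note s = sesD[OF fg]
  note p' = pushoutD[OF p]
  have a: "a \<in> Arr C" "Dom C a = Dom C f" using p by (simp_all add: pushout_def)
  obtain g0 where "(f', g0) \<in> E" using adm_mono_pushout[OF p s(5)] by (auto simp: adm_mono_def)
  obtain g' where g': "g' \<in> Arr C" "Dom C g' = Cod C a'" "Cod C g' = Cod C g"
    "g' \<cdot> f' = Zero C (Cod C a) (Cod C g)" "g' \<cdot> a' = g"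
    by (rule pushoutE[OF p, of "Zero C (Cod C a) (Cod C g)" g]) (use s a p' in simp_all)
  have "is_cokernel C g' f'"
  proof (rule is_cokernelI)
    fix h assume h: "h \<in> Arr C" "Dom C h = Cod C f'" "h \<cdot> f' = Zero C (Dom C f') (Cod C h)"
    have "(h \<cdot> a') \<cdot> f = (h \<cdot> f') \<cdot> a" using h(1,2) p' a by (simp add: assoc)
    also have "\<dots> = Zero C (Dom C f) (Cod C h)" using h p' a by simp
    finally have ha: "(h \<cdot> a') \<cdot> f = Zero C (Dom C f) (Cod C h)" .
    obtain u where "u \<in> Arr C" "Dom C u = Cod C g" "Cod C u = Cod C (h \<cdot> a')" "u \<cdot> g = h \<cdot> a'"
      by (rule ses_desc[OF fg, of "h \<cdot> a'"]) (use ha h(1,2) p' s in simp_all)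
    then have u: "u \<in> Arr C" "Dom C u = Cod C g" "Cod C u = Cod C h" "u \<cdot> g = h \<cdot> a'"
      using h(1,2) p' by simp_all
    have "u \<cdot> g' = h"
      by (rule pushout_unique[OF p])
        (use u h g' p' in \<open>simp_all add: assoc\<close>)
    then show "\<exists>u\<in>Arr C. Dom C u = Cod C g' \<and> Cod C u = Cod C h \<and> u \<cdot> g' = h"
      using u g' by auto
  next
    fix u v assume uv: "u \<in> Arr C" "v \<in> Arr C" "Dom C u = Cod C g'" "Dom C v = Cod C g'"
      "Cod C u = Cod C v" "u \<cdot> g' = v \<cdot> g'"
    have "u \<cdot> (g' \<cdot> a') = v \<cdot> (g' \<cdot> a')" using uv g'(1-3) p' by (simp flip: assoc)
    with uv g' show "u = v" by - (rule ses_epi[OF fg, of u v], simp_all)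
  qed (use g' p' in simp_all)
  then have "(f', g') \<in> E" using \<open>(f', g0) \<in> E\<close> by (rule ses_other_cokernel[rotated])
  then show ?thesis using g' that by blast
qed

lemma ex_pushout:
  assumes "(f, g) \<in> E" "a \<in> Arr C" "Dom C a = Dom C f"
  obtains f' a' where "pushout C f a f' a'"
  using pushout_adm_mono[of f a] assms sesD(5)[OF assms(1)] by blast

text \<open>Taking the quotient of the middle term first gives the same result: the quotient of \<open>T\<close> by
  \<open>A\<close>, where \<open>A \<rightarrowtail> B \<rightarrowtail> T\<close>, is the pushout of \<open>B \<rightarrowtail> T\<close> along \<open>B \<twoheadrightarrow> B/A\<close>.\<close>

lemma ses_composite:
  assumes fp: "(f, p) \<in> E" and js: "(j, s) \<in> E" and d: "Cod C f = Dom C j"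
    and po: "pushout C j p j' p'"
  shows "(j \<cdot> f, p') \<in> E"
proof -
  note a = sesD[OF fp] sesD[OF js] pushoutD[OF po]
  have "adm_mono E (j \<cdot> f)" using a d by (intro comp_adm_mono) simp_all
  then obtain c where c: "(j \<cdot> f, c) \<in> E" by (auto simp: adm_mono_def)
  have "is_cokernel C p' (j \<cdot> f)"
  proof (rule is_cokernelI)
    have "p' \<cdot> (j \<cdot> f) = (p' \<cdot> j) \<cdot> f" using a(1-4,7-9,13-19) d by (simp add: assoc)
    also have "\<dots> = (j' \<cdot> p) \<cdot> f" by (simp only: a(20))
    also have "\<dots> = Zero C (Dom C (j \<cdot> f)) (Cod C p')"
      using a(1-4,7-9,13-19) d by (simp add: assoc)
    finally show "p' \<cdot> (j \<cdot> f) = Zero C (Dom C (j \<cdot> f)) (Cod C p')" .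
  next
    fix h assume h: "h \<in> Arr C" "Dom C h = Cod C (j \<cdot> f)"
      "h \<cdot> (j \<cdot> f) = Zero C (Dom C (j \<cdot> f)) (Cod C h)"
    have hj: "(h \<cdot> j) \<cdot> f = Zero C (Dom C f) (Cod C h)"
      using h a(1-4,7-9) d by (simp add: assoc)
    obtain k where "k \<in> Arr C" "Dom C k = Cod C p" "Cod C k = Cod C (h \<cdot> j)" "k \<cdot> p = h \<cdot> j"
      by (rule ses_desc[OF fp, of "h \<cdot> j"]) (use hj h(1,2) a(1-4,7-9) d in simp_all)
    then have k: "k \<in> Arr C" "Dom C k = Cod C p" "Cod C k = Cod C h" "k \<cdot> p = h \<cdot> j"
      using h(1,2) a(1-4,7-9) d by simp_all
    obtain u where "u \<in> Arr C" "Dom C u = Cod C p'" "Cod C u = Cod C h" "u \<cdot> p' = h"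
      by (rule pushoutE[OF po, of k h]) (use h k a(1-4,7-9) d in simp_all)
    then show "\<exists>u\<in>Arr C. Dom C u = Cod C p' \<and> Cod C u = Cod C h \<and> u \<cdot> p' = h" by blast
  next
    fix u v assume uv: "u \<in> Arr C" "v \<in> Arr C" "Dom C u = Cod C p'" "Dom C v = Cod C p'"
      "Cod C u = Cod C v" "u \<cdot> p' = v \<cdot> p'"
    have x: "(w \<cdot> j') \<cdot> p = (w \<cdot> p') \<cdot> j" if "w \<in> Arr C" "Dom C w = Cod C p'" for w
      using that a(1-4,7-9,13-19) d by (simp add: assoc a(20))
    have "(u \<cdot> j') \<cdot> p = (v \<cdot> j') \<cdot> p" using x[OF uv(1,3)] x[OF uv(2,4)] uv(6) by simp
    with uv a(1-4,7-9,13-19) d have "u \<cdot> j' = v \<cdot> j'"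
      by - (rule ses_epi[OF fp, of "u \<cdot> j'"], simp_all)
    with uv show "u = v" by - (rule pushout_unique[OF po], simp_all)
  qed (use a(1-4,7-9,13-19) d in simp_all)
  then show ?thesis by (rule ses_other_cokernel[OF c])
qed

text \<open>Given a section \<open>s\<close> of \<open>g\<close>, the endomorphism \<open>1 - s \<cdot> g\<close> is killed by \<open>g\<close>, hence factors
  through the kernel \<open>f\<close>; the factor is the missing retraction.\<close>

lemma section_biproduct:
  assumes fg: "(f, g) \<in> E" and s: "s \<in> Arr C" "Dom C s = Cod C g" "Cod C s = Dom C g"
    "g \<cdot> s = Idn C (Cod C g)"
  obtains r where "biproduct C (Cod C g) (Dom C f) (Dom C g) s f g r"
proof -
  note a = sesD[OF fg]
  obtain d where d: "d \<in> Arr C" "Dom C d = Dom C (s \<cdot> g)" "Cod C d = Cod C (s \<cdot> g)"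
    "Idn C (Dom C g) = s \<cdot> g \<boxplus> d"
    by (rule ex_diff[of "Idn C (Dom C g)" "s \<cdot> g"]) (use a s in simp_all)
  have d': "Dom C d = Dom C g" "Cod C d = Dom C g" using d(2,3) a s by simp_all
  have "g = g \<cdot> Idn C (Dom C g)" using a by simp
  also have "\<dots> = g \<cdot> (s \<cdot> g) \<boxplus> g \<cdot> d" using a s d(1) d' by (simp only: d(4)) simp
  also have "g \<cdot> (s \<cdot> g) = g" using a s by (simp flip: assoc)
  finally have "g \<boxplus> g \<cdot> d = g \<boxplus> Zero C (Dom C g) (Cod C g)" using a by simp
  then have gd: "g \<cdot> d = Zero C (Dom C g) (Cod C g)"
    by (rule add_cancel[rotated -1]) (use a d(1) d' in simp_all)
  obtain r where "r \<in> Arr C" "Cod C r = Dom C f" "Dom C r = Dom C d" "f \<cdot> r = d"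
    by (rule ses_lift[OF fg d(1)]) (use d' gd in simp_all)
  then have r: "r \<in> Arr C" "Cod C r = Dom C f" "Dom C r = Dom C g" "f \<cdot> r = d" using d' by simp_all
  have "f = Idn C (Dom C g) \<cdot> f" using a by simp
  also have "\<dots> = s \<cdot> (g \<cdot> f) \<boxplus> d \<cdot> f" using a(1-3) s d(1) d' by (simp only: d(4)) (simp add: assoc)
  finally have "d \<cdot> f = f" using a s d(1) d' by simp
  then have "f \<cdot> (r \<cdot> f) = f" using r a by (simp flip: assoc)
  with r a have rf: "r \<cdot> f = Idn C (Dom C f)" by - (rule ses_mono[OF fg], simp_all)
  have "s = Idn C (Dom C g) \<cdot> s" using s by simp
  also have "\<dots> = s \<cdot> (g \<cdot> s) \<boxplus> d \<cdot> s" using a(1-3) s(1-3) d(1) d' by (simp only: d(4)) (simp add: assoc)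
  finally have "s \<boxplus> d \<cdot> s = s \<boxplus> Zero C (Cod C g) (Dom C g)" using a s by simp
  then have "d \<cdot> s = Zero C (Cod C g) (Dom C g)"
    by (rule add_cancel[rotated -1]) (use a s d(1) d' in simp_all)
  then have "f \<cdot> (r \<cdot> s) = f \<cdot> Zero C (Cod C g) (Dom C f)" using r a s by (simp flip: assoc)
  with r a s have "r \<cdot> s = Zero C (Cod C g) (Dom C f)"
    by - (rule ses_mono[OF fg], simp_all)
  then show ?thesis using a s r rf d(4)
    by (intro that[of r]) (simp add: biproduct_def in_Hom)
qed

lemma section_if_retraction:
  assumes fg: "(f, g) \<in> E" and r: "r \<in> Arr C" "Dom C r = Cod C f" "Cod C r = Dom C f"
    "r \<cdot> f = Idn C (Dom C f)"
  obtains s where "s \<in> Arr C" "Dom C s = Cod C g" "Cod C s = Dom C g" "g \<cdot> s = Idn C (Cod C g)"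
proof -
  interpret op: exact_category "op_cat C" "E\<inverse>" by (rule exact_category_op)
  obtain s where "biproduct (op_cat C) (Dom C f) (Cod C g) (Cod C f) r g f s"
    by (rule op.section_biproduct[of g f r]) (use fg r sesD[OF fg] in simp_all)
  then have "biproduct C (Dom C f) (Cod C g) (Cod C f) f s r g" by simp
  then show ?thesis using sesD[OF fg] by (intro that[of s]) (auto simp: biproduct_def in_Hom)
qed

end

text \<open>The sequence \<open>X = X \<twoheadrightarrow> 0\<close>; it puts the objects of \<open>\<W>\<close> into the heart.\<close>

lemma (in exact_category) ses_id:
  assumes "X \<in> Obj C"
  obtains s where "(Idn C X, s) \<in> E" "zero_object C (Cod C s)"
proof -
  obtain s where s: "(Idn C X, s) \<in> E" using id_adm_mono[OF assms] by (auto simp: adm_mono_def)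
  note sD = sesD(1-4)[OF s]
  have "s = Zero C X (Cod C s)" using sD assms by simp
  then have "Idn C (Cod C s) \<cdot> s = Zero C (Cod C s) (Cod C s) \<cdot> s" using sD assms by simp
  then have "Idn C (Cod C s) = Zero C (Cod C s) (Cod C s)"
    by (rule ses_epi[OF s, rotated -1]) (use sD in simp_all)
  then show ?thesis using s sD by (intro that zero_objectI) simp_all
qed

section \<open>Cotorsion pairs\<close>

text \<open>A self-dual rendering of cotorsion pairs: vanishing of Ext is replaced by the splitting of every
  sequence, and every other condition is paired with its mirror image. Exchanging \<open>U\<close> and \<open>V\<close> then
  gives a cotorsion pair on the opposite category, so each fact about one class yields a fact about
  the other.\<close>

locale cotorsion = exact_category +
  fixes U V :: "'a set"
  assumes U_obj: "U \<subseteq> Obj C" and V_obj: "V \<subseteq> Obj C"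
    and U_summand: "summand_closed C U" and V_summand: "summand_closed C V"
    and ext_split: "\<lbrakk>(f, g) \<in> E; Dom C f \<in> V; Cod C g \<in> U\<rbrakk>
      \<Longrightarrow> \<exists>j p. biproduct C (Dom C f) (Cod C g) (Cod C f) f j p g"
    and ex_precover: "B \<in> Obj C \<Longrightarrow> \<exists>X\<in>V. \<exists>Y\<in>U. ses C E X Y B"
    and ex_preenvelope: "B \<in> Obj C \<Longrightarrow> \<exists>X\<in>V. \<exists>Y\<in>U. ses C E B X Y"

lemma (in exact_category) cotorsion_if_cotorsion_pair:
  assumes cp: "cotorsion_pair C E U V"
  shows "cotorsion C E U V"
proof
  fix f g assume fg: "(f, g) \<in> E" and V: "Dom C f \<in> V" and U: "Cod C g \<in> U"
  note s = sesD[OF fg]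
  have id: "is_iso C (Idn C (Cod C f))" using s
    by (auto simp: is_iso_def in_Hom intro!: bexI[of _ "Idn C (Cod C f)"])
  have e: "(f, g) \<in> extensions C E (Cod C g) (Dom C f)" using fg by (simp add: extensions_def)
  \<comment> \<open>reflexivity places \<open>(f, g)\<close> in its own class, which has to be the class of split sequences\<close>
  moreover have "((f, g), (f, g)) \<in> ext_equiv C E (Cod C g) (Dom C f)"
    using e id s by (auto simp: ext_equiv_def in_Hom intro!: bexI[of _ "Idn C (Cod C f)"])
  moreover have "Ext1 C E (Cod C g) (Dom C f) = {Ext1_zero C E (Cod C g) (Dom C f)}"
    using cp U V by (simp add: cotorsion_pair_def)
  ultimately have "(f, g) \<in> Ext1_zero C E (Cod C g) (Dom C f)"
    unfolding Ext1_def quotient_def by blast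
  then show "\<exists>j p. biproduct C (Dom C f) (Cod C g) (Cod C f) f j p g"
    by (simp add: Ext1_zero_def)
qed (use cp in \<open>auto simp: cotorsion_pair_def additive_sub_def\<close>)

context cotorsion
begin

lemma cotorsion_op: "cotorsion (op_cat C) (E\<inverse>) V U"
proof -
  interpret op: exact_category "op_cat C" "E\<inverse>" by (rule exact_category_op)
  show ?thesis
  proof
    fix f g assume "(f, g) \<in> E\<inverse>" and d: "Dom (op_cat C) f \<in> U" "Cod (op_cat C) g \<in> V"
    then have gf: "(g, f) \<in> E" by simp
    then obtain j p where "biproduct C (Dom C g) (Cod C f) (Cod C g) g j p f"
      using ext_split[OF gf] d by auto
    then have "biproduct C (Cod C f) (Dom C g) (Dom C f) j g f p"
      using sesD[OF gf] biproduct_swap by metis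
    then show "\<exists>j p. biproduct (op_cat C) (Dom (op_cat C) f) (Cod (op_cat C) g) (Cod (op_cat C) f) f j p g"
      by auto
  next
    fix B assume "B \<in> Obj (op_cat C)"
    then have B: "B \<in> Obj C" by simp
    show "\<exists>X\<in>U. \<exists>Y\<in>V. ses (op_cat C) (E\<inverse>) X Y B"
      using ex_preenvelope[OF B] unfolding ses_op by auto
    show "\<exists>X\<in>U. \<exists>Y\<in>V. ses (op_cat C) (E\<inverse>) B X Y"
      using ex_precover[OF B] unfolding ses_op by auto
  qed (simp_all add: U_obj V_obj U_summand V_summand)
qed

lemma precover:
  assumes "B \<in> Obj C"
  obtains f g where "(f, g) \<in> E" "Dom C f \<in> V" "Dom C g \<in> U" "Cod C g = B"
  using ex_precover[OF assms] by (auto simp: ses_def in_Hom)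

lemma preenvelope:
  assumes "B \<in> Obj C"
  obtains f g where "(f, g) \<in> E" "Dom C f = B" "Cod C f \<in> V" "Cod C g \<in> U"
  using ex_preenvelope[OF assms] by (auto simp: ses_def in_Hom)

text \<open>The usual consequence of \<open>Ext\<^sup>1(U, V) = 0\<close>: pushing the sequence out along \<open>a\<close> gives an extension
  of an object of \<open>U\<close> by an object of \<open>V\<close>, and a retraction of it extends \<open>a\<close>.\<close>

lemma extend:
  assumes fg: "(f, g) \<in> E" "Cod C g \<in> U" and a: "a \<in> Arr C" "Dom C a = Dom C f" "Cod C a \<in> V"
  obtains b where "b \<in> Arr C" "Dom C b = Cod C f" "Cod C b = Cod C a" "b \<cdot> f = a"
proof -
  obtain f' a' where po: "pushout C f a f' a'"
    by (rule ex_pushout[OF fg(1) a(1,2)])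
  note p' = pushoutD[OF po]
  obtain g' where p: "(f', g') \<in> E" "Cod C g' = Cod C g"
    by (rule ses_pushout[OF fg(1) po])
  obtain j r where "biproduct C (Dom C f') (Cod C g') (Cod C f') f' j r g'"
    using ext_split[OF p(1)] p p' fg a by auto
  then have r: "r \<in> Arr C" "Dom C r = Cod C f'" "Cod C r = Dom C f'" "r \<cdot> f' = Idn C (Dom C f')"
    by (auto simp: biproduct_def in_Hom)
  have "(r \<cdot> a') \<cdot> f = r \<cdot> (f' \<cdot> a)" using r(1-3) p' by (simp add: assoc)
  also have "\<dots> = a" using r p'(1-7) a by (simp flip: assoc)
  finally show ?thesis using r(1-3) p' by (intro that[of "r \<cdot> a'"]) simp_all
qed

lemma lift:
  assumes fg: "(f, g) \<in> E" "Dom C f \<in> V" and a: "a \<in> Arr C" "Cod C a = Cod C g" "Dom C a \<in> U"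
  obtains b where "b \<in> Arr C" "Cod C b = Dom C g" "Dom C b = Dom C a" "g \<cdot> b = a"
proof -
  interpret op: cotorsion "op_cat C" "E\<inverse>" V U by (rule cotorsion_op)
  show ?thesis by (rule op.extend[of g f a]) (use assms that in simp_all)
qed

text \<open>Being left orthogonal to \<open>V\<close> is enough for membership in \<open>U\<close>: the approximation of \<open>Z\<close> by an
  object of \<open>U\<close> splits, and \<open>U\<close> is closed under direct summands.\<close>

lemma U_memI:
  assumes Z: "Z \<in> Obj C"
    and split: "\<And>f g. \<lbrakk>(f, g) \<in> E; Dom C f \<in> V; Cod C g = Z\<rbrakk>
      \<Longrightarrow> \<exists>s\<in>Arr C. Dom C s = Z \<and> Cod C s = Dom C g \<and> g \<cdot> s = Idn C Z"
  shows "Z \<in> U"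
proof -
  obtain f g where fg: "(f, g) \<in> E" "Dom C f \<in> V" "Dom C g \<in> U" "Cod C g = Z"
    by (rule precover[OF Z])
  obtain s where s: "s \<in> Arr C" "Dom C s = Z" "Cod C s = Dom C g" "g \<cdot> s = Idn C Z"
    using split[OF fg(1,2,4)] by blast
  obtain r where "biproduct C (Cod C g) (Dom C f) (Dom C g) s f g r"
    by (rule section_biproduct[OF fg(1), of s]) (use s fg in simp_all)
  then have "direct_summand C Z (Dom C g)" using fg(4) unfolding direct_summand_def by blast
  then show ?thesis using U_summand fg(3) unfolding summand_closed_def by blast
qed

text \<open>Let \<open>A \<rightarrowtail> B \<twoheadrightarrow> A'\<close> have ends in \<open>U\<close> and let \<open>V' \<rightarrowtail> X \<twoheadrightarrow> B\<close> be a sequence to be split.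
  Over \<open>A\<close> it splits, so the kernel \<open>K\<close> of \<open>X \<twoheadrightarrow> A'\<close> retracts onto \<open>V'\<close>; as the quotient of \<open>X\<close> by
  \<open>K\<close> is \<open>A'\<close>, an object of \<open>U\<close>, this retraction extends from \<open>K\<close> to \<open>X\<close>.\<close>

lemma U_extension:
  assumes iq: "(i, q) \<in> E" and U: "Dom C i \<in> U" "Cod C q \<in> U"
  shows "Cod C i \<in> U"
proof (rule U_memI)
  note iqD = sesD(1-4)[OF iq]
  show "Cod C i \<in> Obj C" using iqD by simp
  fix v p assume vp: "(v, p) \<in> E" "Dom C v \<in> V" and cp: "Cod C p = Cod C i"
  note vpD = sesD(1-4)[OF vp(1)]
  have "adm_epi E (q \<cdot> p)" using sesD[OF iq] sesD[OF vp(1)] cp by (intro comp_adm_epi) simp_all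
  then obtain k where k: "(k, q \<cdot> p) \<in> E" by (auto simp: adm_epi_def)
  have dqp: "Dom C (q \<cdot> p) = Dom C p" "Cod C (q \<cdot> p) = Cod C q" using iqD vpD cp by simp_all
  have kD: "k \<in> Arr C" "Cod C k = Dom C p" "(q \<cdot> p) \<cdot> k = Zero C (Dom C k) (Cod C q)"
    using sesD(1-4)[OF k] dqp by simp_all
  \<comment> \<open>the splitting over the subobject\<close>
  obtain l where l: "l \<in> Arr C" "Cod C l = Dom C p" "Dom C l = Dom C i" "p \<cdot> l = i"
    by (rule lift[OF vp, of i]) (use iqD cp U in simp_all)
  have "(q \<cdot> p) \<cdot> v = q \<cdot> (p \<cdot> v)" using iqD vpD(1-3) cp by (simp add: assoc)
  also have "\<dots> = Zero C (Dom C v) (Cod C q)" using iqD vpD cp by simp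
  finally have qpv: "(q \<cdot> p) \<cdot> v = Zero C (Dom C v) (Cod C q)" .
  obtain v' where v': "v' \<in> Arr C" "Cod C v' = Dom C k" "Dom C v' = Dom C v" "k \<cdot> v' = v"
    by (rule ses_lift[OF k, of v]) (use vpD dqp qpv in simp_all)
  have qpk: "q \<cdot> (p \<cdot> k) = Zero C (Dom C k) (Cod C q)" using iqD vpD(1-3) cp kD by (simp flip: assoc)
  obtain t where "t \<in> Arr C" "Cod C t = Dom C i" "Dom C t = Dom C (p \<cdot> k)" "i \<cdot> t = p \<cdot> k"
    by (rule ses_lift[OF iq, of "p \<cdot> k"]) (use iqD vpD(1-3) cp kD qpk in simp_all)
  then have t: "t \<in> Arr C" "Cod C t = Dom C i" "Dom C t = Dom C k" "i \<cdot> t = p \<cdot> k"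
    using vpD(1-3) kD by simp_all
  \<comment> \<open>on \<open>K\<close>, the part of \<open>k\<close> that does not come from \<open>l\<close> lies in the kernel of \<open>p\<close>\<close>
  have lt: "k \<in> Arr C" "l \<cdot> t \<in> Arr C" "Dom C k = Dom C (l \<cdot> t)" "Cod C k = Cod C (l \<cdot> t)"
    using l t kD by simp_all
  obtain d where d': "d \<in> Arr C" "Dom C d = Dom C (l \<cdot> t)" "Cod C d = Cod C (l \<cdot> t)" "k = l \<cdot> t \<boxplus> d"
    by (rule ex_diff[OF lt])
  have d: "d \<in> Arr C" "Dom C d = Dom C k" "Cod C d = Dom C p" "k = l \<cdot> t \<boxplus> d"
    using l t d'(1-3) by (simp, simp, simp, simp only: d'(4)[symmetric])
  have plt: "p \<cdot> (l \<cdot> t) = p \<cdot> k" using l t vpD(1-3) by (simp flip: assoc)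
  have "p \<cdot> k \<boxplus> p \<cdot> d = p \<cdot> (l \<cdot> t \<boxplus> d)" using l(1-3) t(1-3) d(1-3) vpD(1-3) plt by simp
  also have "\<dots> = p \<cdot> k" by (simp only: d(4))
  also have "\<dots> = p \<cdot> k \<boxplus> Zero C (Dom C k) (Cod C p)" using kD vpD(1-3) by simp
  finally have pd: "p \<cdot> d = Zero C (Dom C k) (Cod C p)"
    by (rule add_cancel[rotated -1]) (use kD vpD(1-3) d(1-3) in simp_all)
  obtain r where "r \<in> Arr C" "Cod C r = Dom C v" "Dom C r = Dom C d" "v \<cdot> r = d"
    by (rule ses_lift[OF vp(1), of d]) (use d(1-3) pd in simp_all)
  then have r: "r \<in> Arr C" "Cod C r = Dom C v" "Dom C r = Dom C k" "v \<cdot> r = d"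
    using d(2) by simp_all
  have "i \<cdot> (t \<cdot> v') = (p \<cdot> k) \<cdot> v'" using t v' iqD(1-3) by (simp flip: assoc)
  also have "\<dots> = p \<cdot> v" using v' kD(1-2) vpD(1-3) by (simp add: assoc)
  also have "\<dots> = i \<cdot> Zero C (Dom C v) (Dom C i)" using vpD iqD cp by simp
  finally have tv: "t \<cdot> v' = Zero C (Dom C v) (Dom C i)"
    by (rule ses_mono[OF iq, rotated -1]) (use t v' vpD iqD in simp_all)
  have "v = (l \<cdot> t \<boxplus> d) \<cdot> v'" using v'(4) by (simp only: d(4))
  also have "\<dots> = l \<cdot> (t \<cdot> v') \<boxplus> d \<cdot> v'" using l(1-3) t(1-3) d(1-3) v'(1-3) by (simp add: assoc)
  also have "\<dots> = v \<cdot> (r \<cdot> v')" using tv l(1-3) v'(1-3) vpD(1-3) r by (simp flip: r(4) add: assoc)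
  finally have "v \<cdot> (r \<cdot> v') = v \<cdot> Idn C (Dom C v)" using vpD by simp
  then have rv: "r \<cdot> v' = Idn C (Dom C v)"
    by (rule ses_mono[OF vp(1), rotated -1]) (use r v' vpD in simp_all)
  obtain r' where "r' \<in> Arr C" "Dom C r' = Cod C k" "Cod C r' = Cod C r" "r' \<cdot> k = r"
    by (rule extend[OF k, of r]) (use dqp U r vp in simp_all)
  then have r': "r' \<in> Arr C" "Dom C r' = Cod C v" "Cod C r' = Dom C v" "r' \<cdot> k = r"
    using kD vpD r by simp_all
  have "r' \<cdot> v = r' \<cdot> (k \<cdot> v')" using v' by simp
  also have "\<dots> = Idn C (Dom C v)" using r' v'(1-3) kD(1-2) vpD rv by (simp flip: assoc)
  finally have rv': "r' \<cdot> v = Idn C (Dom C v)" .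
  obtain s where "s \<in> Arr C" "Dom C s = Cod C p" "Cod C s = Dom C p" "p \<cdot> s = Idn C (Cod C p)"
    by (rule section_if_retraction[OF vp(1), of r']) (use r' rv' in simp_all)
  then show "\<exists>s\<in>Arr C. Dom C s = Cod C i \<and> Cod C s = Dom C p \<and> p \<cdot> s = Idn C (Cod C i)"
    using cp by auto
qed

lemma U_biproduct:
  assumes b: "biproduct C X Y Z i j p q" and XY: "X \<in> U" "Y \<in> U"
  shows "Z \<in> U"
proof (rule U_memI)
  note b' = b[unfolded biproduct_def in_Hom]
  show "Z \<in> Obj C" using b' by simp
  fix f g assume fg: "(f, g) \<in> E" "Dom C f \<in> V" "Cod C g = Z"
  obtain l where l: "l \<in> Arr C" "Cod C l = Dom C g" "Dom C l = X" "g \<cdot> l = i"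
    by (rule lift[OF fg(1,2), of i]) (use b' fg XY in simp_all)
  obtain m where m: "m \<in> Arr C" "Cod C m = Dom C g" "Dom C m = Y" "g \<cdot> m = j"
    by (rule lift[OF fg(1,2), of j]) (use b' fg XY in simp_all)
  have "g \<cdot> (l \<cdot> p \<boxplus> m \<cdot> q) = Idn C Z"
    using l m b' sesD(2)[OF fg(1)] by (simp flip: assoc)
  then show "\<exists>s\<in>Arr C. Dom C s = Z \<and> Cod C s = Dom C g \<and> g \<cdot> s = Idn C Z"
    using l m b' by (intro bexI[of _ "l \<cdot> p \<boxplus> m \<cdot> q"]) simp_all
qed

lemma U_zero:
  assumes Z: "zero_object C Z"
  shows "Z \<in> U"
proof (rule U_memI)
  show Zo: "Z \<in> Obj C" using Z by (simp add: zero_object_def)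
  fix f g assume fg: "(f, g) \<in> E" "Dom C f \<in> V" "Cod C g = Z"
  have "f = g" if "f \<in> Hom C Z Z" "g \<in> Hom C Z Z" for f g
    using Z Zo that unfolding zero_object_def by blast
  then have "g \<cdot> Zero C Z (Dom C g) = Idn C Z"
    using sesD(2)[OF fg(1)] fg(3) Zo by (simp add: in_Hom)
  then show "\<exists>s\<in>Arr C. Dom C s = Z \<and> Cod C s = Dom C g \<and> g \<cdot> s = Idn C Z"
    using Zo sesD(2)[OF fg(1)] by (intro bexI[of _ "Zero C Z (Dom C g)"]) simp_all
qed

lemma V_biproduct:
  assumes "biproduct C X Y Z i j p q" "X \<in> V" "Y \<in> V"
  shows "Z \<in> V"
proof -
  interpret op: cotorsion "op_cat C" "E\<inverse>" V U by (rule cotorsion_op)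
  show ?thesis using op.U_biproduct[of X Y Z p q i j] assms by simp
qed

lemma V_zero: "zero_object C Z \<Longrightarrow> Z \<in> V"
proof -
  interpret op: cotorsion "op_cat C" "E\<inverse>" V U by (rule cotorsion_op)
  show "zero_object C Z \<Longrightarrow> Z \<in> V" using op.U_zero[of Z] by (simp add: zero_object_op)
qed

end

section \<open>Twin cotorsion pairs\<close>

lemma BminusI:
  assumes "(i, s) \<in> E" "i \<in> Arr C" "s \<in> Arr C" "Cod C i = Dom C s" "Dom C i \<in> Obj C"
    "Cod C i \<in> W" "Cod C s \<in> S"
  shows "Dom C i \<in> Bminus C E W S"
  using assms by (auto simp: Bminus_def ses_def in_Hom)

lemma BminusE:
  assumes "B \<in> Bminus C E W S"
  obtains i s where "(i, s) \<in> E" "Dom C i = B" "Cod C i \<in> W" "Cod C s \<in> S"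
  using assms by (auto simp: Bminus_def ses_def in_Hom)

lemma BplusI:
  assumes "(v, p) \<in> E" "v \<in> Arr C" "p \<in> Arr C" "Cod C v = Dom C p" "Cod C p \<in> Obj C"
    "Cod C v \<in> W" "Dom C v \<in> V"
  shows "Cod C p \<in> Bplus C E W V"
  using assms by (auto simp: Bplus_def ses_def in_Hom)

lemma BplusE:
  assumes "B \<in> Bplus C E W V"
  obtains v p where "(v, p) \<in> E" "Cod C p = B" "Dom C p \<in> W" "Dom C v \<in> V"
  using assms by (auto simp: Bplus_def ses_def in_Hom)

lemma Bplus_op: "Bplus (op_cat C) (E\<inverse>) W S = Bminus C E W S"
  by (auto simp: Bplus_def Bminus_def)

lemma Bminus_op: "Bminus (op_cat C) (E\<inverse>) W V = Bplus C E W V"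
  by (auto simp: Bplus_def Bminus_def)

text \<open>A direct sum of two sequences \<open>B \<rightarrowtail> W \<twoheadrightarrow> S\<close> is of the same form.\<close>

lemma (in exact_category) Bminus_biproduct:
  assumes W: "\<And>X Y. \<lbrakk>X \<in> W; Y \<in> W\<rbrakk> \<Longrightarrow> \<exists>Z\<in>W. \<exists>i j p q. biproduct C X Y Z i j p q"
    and S: "\<And>X Y. \<lbrakk>X \<in> S; Y \<in> S\<rbrakk> \<Longrightarrow> \<exists>Z\<in>S. \<exists>i j p q. biproduct C X Y Z i j p q"
    and XY: "X \<in> Bminus C E W S" "Y \<in> Bminus C E W S"
    and Z: "biproduct C X Y Z i j p q"
  shows "Z \<in> Bminus C E W S"
proof -
  obtain i1 s1 where 1: "(i1, s1) \<in> E" "Dom C i1 = X" "Cod C i1 \<in> W" "Cod C s1 \<in> S"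
    using XY(1) by (rule BminusE)
  obtain i2 s2 where 2: "(i2, s2) \<in> E" "Dom C i2 = Y" "Cod C i2 \<in> W" "Cod C s2 \<in> S"
    using XY(2) by (rule BminusE)
  note s1 = sesD(1-3)[OF 1(1)] and s2 = sesD(1-3)[OF 2(1)]
  obtain Z' i' j' p' q' where Z': "Z' \<in> W" "biproduct C (Cod C i1) (Cod C i2) Z' i' j' p' q'"
    using W[OF 1(3) 2(3)] by blast
  obtain Z'' i'' j'' p'' q'' where Z'': "Z'' \<in> S"
    "biproduct C (Cod C s1) (Cod C s2) Z'' i'' j'' p'' q''"
    using S[OF 1(4) 2(4)] by blast
  note b = Z[unfolded biproduct_def in_Hom] and b' = Z'(2)[unfolded biproduct_def in_Hom]
    and b'' = Z''(2)[unfolded biproduct_def in_Hom]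
  let ?k = "i' \<cdot> (i1 \<cdot> p) \<boxplus> j' \<cdot> (i2 \<cdot> q)" and ?h = "i'' \<cdot> (s1 \<cdot> p') \<boxplus> j'' \<cdot> (s2 \<cdot> q')"
  have k: "?k \<in> Arr C" "Dom C ?k = Z" "Cod C ?k = Z'" using b b' s1 s2 1 2 by simp_all
  have h: "?h \<in> Arr C" "Dom C ?h = Z'" "Cod C ?h = Z''" using b' b'' s1 s2 1 2 by simp_all
  have m: "sum_morphism C i1 i2 ?k i j i' j'" "sum_morphism C s1 s2 ?h i' j' i'' j''"
    using b b' b'' s1 s2 1 2 by (simp_all add: sum_morphism_def assoc)
  have "pair_direct_sum C (i1, s1) (i2, s2) (?k, ?h)"
    unfolding pair_direct_sum_def fst_conv snd_conv
  proof (intro conjI exI)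
    show "biproduct C (Dom C i1) (Dom C i2) (Dom C ?k) i j p q" using Z 1 2 k by simp
    show "biproduct C (Cod C i1) (Cod C i2) (Cod C ?k) i' j' p' q'" using Z' k by simp
    show "biproduct C (Cod C s1) (Cod C s2) (Cod C ?h) i'' j'' p'' q''" using Z'' h by simp
  qed (use m s1 s2 k h in \<open>simp_all add: composable_pair_def\<close>)
  then have "(?k, ?h) \<in> E" using ses_direct_sum 1 2 by blast
  then show ?thesis using BminusI[of ?k ?h E C W S] k h Z' Z'' b by simp
qed

locale twin_cotorsion = exact_category + ST: cotorsion C E S T + UV: cotorsion C E U V
  for S T U V +
  assumes S_sub_U: "S \<subseteq> U" and V_sub_T: "V \<subseteq> T"

text \<open>The inclusion of left classes forces \<open>V \<subseteq> T\<close>, since \<open>V\<close> is right orthogonal to \<open>U\<close> and a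
  fortiori to \<open>S\<close>. With both inclusions as assumptions the locale is self-dual.\<close>

lemma (in exact_category) twin_cotorsion_if_pair:
  assumes "twin_cotorsion_pair C E S T U V"
  shows "twin_cotorsion C E S T U V"
proof -
  interpret ST: cotorsion C E S T
    using assms by (intro cotorsion_if_cotorsion_pair) (simp add: twin_cotorsion_pair_def)
  interpret UV: cotorsion C E U V
    using assms by (intro cotorsion_if_cotorsion_pair) (simp add: twin_cotorsion_pair_def)
  interpret op: cotorsion "op_cat C" "E\<inverse>" T S by (rule ST.cotorsion_op)
  have SU: "S \<subseteq> U" using assms by (simp add: twin_cotorsion_pair_def)
  have "Z \<in> T" if Z: "Z \<in> V" for Z
  proof (rule op.U_memI)
    show "Z \<in> Obj (op_cat C)" using Z UV.V_obj by auto
    fix f g assume "(f, g) \<in> E\<inverse>" "Dom (op_cat C) f \<in> S" "Cod (op_cat C) g = Z"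
    then have gf: "(g, f) \<in> E" "Dom C g = Z" "Cod C f \<in> U" using SU by auto
    then obtain j p where "biproduct C (Dom C g) (Cod C f) (Cod C g) g j p f"
      using UV.ext_split[of g f] Z by auto
    then have "p \<in> Arr C" "Cod C p = Z" "Dom C p = Cod C g" "p \<cdot> g = Idn C Z"
      using gf by (simp_all add: biproduct_def in_Hom)
    then show "\<exists>s\<in>Arr (op_cat C). Dom (op_cat C) s = Z \<and> Cod (op_cat C) s = Dom (op_cat C) g \<and>
      g \<cdot>\<^bsub>op_cat C\<^esub> s = Idn (op_cat C) Z" by auto
  qed
  then show ?thesis using SU by unfold_locales auto
qed

context twin_cotorsion
begin

lemma twin_cotorsion_op: "twin_cotorsion (op_cat C) (E\<inverse>) V U T S"
proof -
  interpret op1: cotorsion "op_cat C" "E\<inverse>" T S by (rule ST.cotorsion_op)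
  interpret op2: cotorsion "op_cat C" "E\<inverse>" V U by (rule UV.cotorsion_op)
  show ?thesis using S_sub_U V_sub_T by unfold_locales
qed

abbreviation "W \<equiv> T \<inter> U"
abbreviation "Bp \<equiv> Bplus C E W V"
abbreviation "Bm \<equiv> Bminus C E W S"
abbreviation "H \<equiv> Bp \<inter> Bm"

lemma W_biproduct:
  assumes "X \<in> W" "Y \<in> W"
  shows "\<exists>Z\<in>W. \<exists>i j p q. biproduct C X Y Z i j p q"
proof -
  obtain Z i j p q where Z: "biproduct C X Y Z i j p q"
    using ex_biproduct[of X Y] assms UV.U_obj by blast
  then have "Z \<in> W" using ST.V_biproduct[OF Z] UV.U_biproduct[OF Z] assms by blast
  then show ?thesis using Z by blast
qed

sublocale additive_quotient C W
proof
  show "W \<subseteq> Obj C" using UV.U_obj by auto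
  obtain Z where "zero_object C Z" using ex_zero_object by blast
  then show "W \<noteq> {}" using ST.V_zero UV.U_zero by blast
qed (rule W_biproduct)

text \<open>Negligibility of a morphism with target in \<open>\<B>\<^sup>+\<close>, or with source in \<open>\<B>\<^sup>-\<close>, can be tested on the
  sequence that defines that class.\<close>

lemma negligible_lift:
  assumes "(v, p) \<in> E" "Dom C v \<in> V" "negligible f" "Cod C f = Cod C p"
  obtains k where "k \<in> Arr C" "Cod C k = Dom C p" "Dom C k = Dom C f" "p \<cdot> k = f"
proof -
  obtain a b where ab: "a \<in> Arr C" "b \<in> Arr C" "Cod C a = Dom C b" "Dom C b \<in> W"
    "Dom C f = Dom C a" "Cod C f = Cod C b" "f = b \<cdot> a" using assms(3) by (rule negligibleE)
  obtain l where l: "l \<in> Arr C" "Cod C l = Dom C p" "Dom C l = Dom C b" "p \<cdot> l = b"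
    by (rule UV.lift[OF assms(1,2), of b]) (use ab assms(4) in simp_all)
  have "p \<cdot> (l \<cdot> a) = f" using l ab sesD(2)[OF assms(1)] by (simp flip: assoc)
  then show ?thesis using l ab by (intro that[of "l \<cdot> a"]) simp_all
qed

lemma negligible_extend:
  assumes "(i, s) \<in> E" "Cod C s \<in> S" "negligible f" "Dom C f = Dom C i"
  obtains k where "k \<in> Arr C" "Dom C k = Cod C i" "Cod C k = Cod C f" "k \<cdot> i = f"
proof -
  obtain a b where ab: "a \<in> Arr C" "b \<in> Arr C" "Cod C a = Dom C b" "Dom C b \<in> W"
    "Dom C f = Dom C a" "Cod C f = Cod C b" "f = b \<cdot> a" using assms(3) by (rule negligibleE)
  obtain l where l: "l \<in> Arr C" "Dom C l = Cod C i" "Cod C l = Cod C a" "l \<cdot> i = a"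
    by (rule ST.extend[OF assms(1,2), of a]) (use ab assms(4) in simp_all)
  have "(b \<cdot> l) \<cdot> i = f" using l ab sesD(1)[OF assms(1)] by (simp add: assoc)
  then show ?thesis using l ab by (intro that[of "b \<cdot> l"]) simp_all
qed

text \<open>This gives uniqueness of factorizations modulo \<open>\<W>\<close>. Let \<open>p : W' \<twoheadrightarrow> Y\<close> be the
  epimorphism that puts the target \<open>Y\<close> of \<open>u\<close> in \<open>\<B>\<^sup>+\<close>. Then \<open>u \<cdot> m\<close> lifts along \<open>p\<close>, and the lift extends along \<open>m\<close> because
  \<open>Ext\<^sup>1(S, T) = 0\<close>. So up to a morphism through \<open>W'\<close>, \<open>u\<close> vanishes on \<open>m\<close> and factors through an
  object of \<open>S \<subseteq> U\<close>, from where it lifts along \<open>p\<close> as well.\<close>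

lemma negligible_if_comp_negligible:
  assumes ms: "(m, s) \<in> E" "Cod C s \<in> S"
    and u: "u \<in> Arr C" "Dom C u = Cod C m" "Cod C u \<in> Bp" "negligible (u \<cdot> m)"
  shows "negligible u"
proof -
  note msD = sesD(1-4)[OF ms(1)]
  obtain v p where vp: "(v, p) \<in> E" "Cod C p = Cod C u" "Dom C p \<in> W" "Dom C v \<in> V"
    using u(3) by (rule BplusE)
  note pD = sesD(2)[OF vp(1)]
  have um: "Dom C (u \<cdot> m) = Dom C m" "Cod C (u \<cdot> m) = Cod C u" using u msD by simp_all
  obtain k where "k \<in> Arr C" "Cod C k = Dom C p" "Dom C k = Dom C (u \<cdot> m)" "p \<cdot> k = u \<cdot> m"
    by (rule negligible_lift[OF vp(1,4) u(4)]) (use um vp in simp_all)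
  then have k: "k \<in> Arr C" "Cod C k = Dom C p" "Dom C k = Dom C m" "p \<cdot> k = u \<cdot> m"
    using um by simp_all
  obtain k' where "k' \<in> Arr C" "Dom C k' = Cod C m" "Cod C k' = Cod C k" "k' \<cdot> m = k"
    by (rule ST.extend[OF ms, of k]) (use k vp in simp_all)
  then have k': "k' \<in> Arr C" "Dom C k' = Cod C m" "Cod C k' = Dom C p" "k' \<cdot> m = k"
    using k by simp_all
  have diff: "u \<in> Arr C" "p \<cdot> k' \<in> Arr C" "Dom C u = Dom C (p \<cdot> k')" "Cod C u = Cod C (p \<cdot> k')"
    using u k' pD vp by simp_all
  obtain d where d': "d \<in> Arr C" "Dom C d = Dom C (p \<cdot> k')" "Cod C d = Cod C (p \<cdot> k')"
    "u = p \<cdot> k' \<boxplus> d" by (rule ex_diff[OF diff])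
  have d: "d \<in> Arr C" "Dom C d = Cod C m" "Cod C d = Cod C u"
    using d'(1-3) k' pD vp by simp_all
  have pkm: "p \<cdot> (k' \<cdot> m) = u \<cdot> m" using k k' by simp
  have "u \<cdot> m \<boxplus> d \<cdot> m = (p \<cdot> k' \<boxplus> d) \<cdot> m" using d k'(1-3) msD pD vp(2) pkm by (simp add: assoc)
  also have "\<dots> = u \<cdot> m" by (simp only: d'(4))
  also have "\<dots> = u \<cdot> m \<boxplus> Zero C (Dom C m) (Cod C u)" using u msD by simp
  finally have dm: "d \<cdot> m = Zero C (Dom C m) (Cod C d)"
    unfolding d(3) by (rule add_cancel[rotated -1]) (use d u msD in simp_all)
  obtain e where e: "e \<in> Arr C" "Dom C e = Cod C s" "Cod C e = Cod C d" "e \<cdot> s = d"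
    by (rule ses_desc[OF ms(1), of d]) (use d msD dm in simp_all)
  obtain l where l: "l \<in> Arr C" "Cod C l = Dom C p" "Dom C l = Dom C e" "p \<cdot> l = e"
    by (rule UV.lift[OF vp(1,4), of e]) (use e d vp ms(2) S_sub_U in auto)
  have "u = p \<cdot> k' \<boxplus> p \<cdot> (l \<cdot> s)" using d'(4) e l msD pD by (simp flip: assoc)
  also have "\<dots> = p \<cdot> (k' \<boxplus> l \<cdot> s)" using k' l(1-3) e(1-3) msD pD by simp
  also have "negligible \<dots>" using k' l(1-3) e(1-3) msD pD vp(3) by (intro negligibleI) simp_all
  finally show ?thesis .
qed

text \<open>For \<open>B \<rightarrowtail> N \<twoheadrightarrow> S'\<close> and \<open>B \<rightarrowtail> W' \<twoheadrightarrow> S''\<close>, the pushout \<open>X\<close> of the two monomorphisms is an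
  extension of \<open>S'\<close> by \<open>W'\<close>, hence lies in \<open>U\<close>. Embedding \<open>X\<close> into an object of \<open>T\<close> with cokernel
  in \<open>S\<close> stays inside \<open>U\<close>, and the cokernel of the composite embedding of \<open>N\<close> is an extension of two
  objects of \<open>S\<close>.\<close>

lemma Bm_extension:
  assumes ms: "(m, s') \<in> E" "Dom C m \<in> Bm" "Cod C s' \<in> S"
  shows "Cod C m \<in> Bm"
proof -
  note msD = sesD(1-4)[OF ms(1)]
  obtain i s where is': "(i, s) \<in> E" "Dom C i = Dom C m" "Cod C i \<in> W" "Cod C s \<in> S"
    using ms(2) by (rule BminusE)
  obtain i1 m1 where po: "pushout C i m i1 m1"
    by (rule ex_pushout[OF is'(1), of m]) (use is' msD in simp_all)
  note poD = pushoutD[OF po]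
  obtain q where q: "(i1, q) \<in> E" "Cod C q = Cod C s" by (rule ses_pushout[OF is'(1) po])
  obtain r where r: "(m1, r) \<in> E" "Cod C r = Cod C s'"
    by (rule ses_pushout[OF ms(1) pushout_swap[OF po]])
  have X: "Cod C i1 \<in> U"
    using UV.U_extension[OF r(1)] r(2) poD is'(3) ms(3) S_sub_U by auto
  obtain j t where jt: "(j, t) \<in> E" "Dom C j = Cod C i1" "Cod C j \<in> T" "Cod C t \<in> S"
    by (rule ST.preenvelope[of "Cod C i1"]) (use poD in simp_all)
  have jW: "Cod C j \<in> W" using UV.U_extension[OF jt(1)] jt X S_sub_U by auto
  note qD = sesD(1-3)[OF q(1)] and jD = sesD(1-3)[OF jt(1)]
  obtain j' q' where po2: "pushout C j q j' q'"
    by (rule ex_pushout[OF jt(1), of q]) (use qD jt in simp_all)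
  note po2D = pushoutD[OF po2]
  obtain t' where t': "(j', t') \<in> E" "Cod C t' = Cod C t" by (rule ses_pushout[OF jt(1) po2])
  have "Cod C j' \<in> S" using ST.U_extension[OF t'(1)] t'(2) po2D q is' jt by simp
  moreover have "(j \<cdot> i1, q') \<in> E" by (rule ses_composite[OF q(1) jt(1) _ po2]) (use jt in simp)
  ultimately have "Dom C (j \<cdot> i1) \<in> Bm"
    by (intro BminusI[of "j \<cdot> i1" q']) (use jW jt qD jD poD po2D in simp_all)
  then show ?thesis using jt qD jD poD by simp
qed

text \<open>The reflection of \<open>M\<close> into \<open>\<B>\<^sup>+\<close>: cover \<open>M\<close> by an object of \<open>U\<close>, embed that object into one of
  \<open>T\<close>, which then lies in \<open>\<W>\<close>, and push out. A morphism from \<open>M\<close> into \<open>\<B>\<^sup>+\<close> lifts on the cover to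
  an object of \<open>\<W>\<close>, and this lift extends to the embedding.\<close>

lemma reflection:
  assumes M: "M \<in> Obj C"
  obtains c s where "(c, s) \<in> E" "Dom C c = M" "Cod C s \<in> S" "Cod C c \<in> Bp"
    "\<And>g. \<lbrakk>g \<in> Arr C; Dom C g = M; Cod C g \<in> Bp\<rbrakk>
      \<Longrightarrow> \<exists>u\<in>Arr C. Dom C u = Cod C c \<and> Cod C u = Cod C g \<and> u \<cdot> c = g"
proof -
  obtain v p where vp: "(v, p) \<in> E" "Dom C v \<in> V" "Dom C p \<in> U" "Cod C p = M"
    by (rule UV.precover[OF M])
  note vpD = sesD(1-3)[OF vp(1)]
  obtain j s where js: "(j, s) \<in> E" "Dom C j = Dom C p" "Cod C j \<in> T" "Cod C s \<in> S"
    by (rule ST.preenvelope[of "Dom C p"]) (use vpD in simp_all)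
  note jsD = sesD(1-3)[OF js(1)]
  have jW: "Cod C j \<in> W" using UV.U_extension[OF js(1)] js vp S_sub_U by auto
  obtain c p' where po: "pushout C j p c p'"
    by (rule ex_pushout[OF js(1), of p]) (use vpD js in simp_all)
  note poD = pushoutD[OF po]
  obtain s' where s': "(c, s') \<in> E" "Cod C s' = Cod C s" by (rule ses_pushout[OF js(1) po])
  have "(j \<cdot> v, p') \<in> E" by (rule ses_composite[OF vp(1) js(1) _ po]) (use js vpD in simp)
  then have "Cod C p' \<in> Bp"
    by (rule BplusI) (use vpD jsD js poD jW vp in simp_all)
  then have "Cod C c \<in> Bp" using poD by simp
  moreover have "\<exists>u\<in>Arr C. Dom C u = Cod C c \<and> Cod C u = Cod C g \<and> u \<cdot> c = g"
    if g: "g \<in> Arr C" "Dom C g = M" "Cod C g \<in> Bp" for g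
  proof -
    obtain v' p'' where vp': "(v', p'') \<in> E" "Cod C p'' = Cod C g" "Dom C p'' \<in> W" "Dom C v' \<in> V"
      using g(3) by (rule BplusE)
    note p''D = sesD(2)[OF vp'(1)]
    obtain l where "l \<in> Arr C" "Cod C l = Dom C p''" "Dom C l = Dom C (g \<cdot> p)" "p'' \<cdot> l = g \<cdot> p"
      by (rule UV.lift[OF vp'(1,4), of "g \<cdot> p"]) (use g vp vpD vp' in simp_all)
    then have l: "l \<in> Arr C" "Cod C l = Dom C p''" "Dom C l = Dom C p" "p'' \<cdot> l = g \<cdot> p"
      using g vp vpD by simp_all
    obtain e where e: "e \<in> Arr C" "Dom C e = Cod C j" "Cod C e = Cod C l" "e \<cdot> j = l"
      by (rule ST.extend[OF js(1,4), of l]) (use l js vp' in simp_all)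
    have x: "g \<cdot> p = (p'' \<cdot> e) \<cdot> j" using l e p''D jsD by (simp add: assoc)
    obtain u where "u \<in> Arr C" "Dom C u = Cod C p'" "Cod C u = Cod C (p'' \<cdot> e)" "u \<cdot> c = g"
      by (rule pushoutE[OF po, of g "p'' \<cdot> e"]) (use x g vp vp' p''D e l in simp_all)
    then show ?thesis using poD p''D e l vp' by (intro bexI[of _ u]) simp_all
  qed
  ultimately show ?thesis using s' js poD vp by (intro that[of c s']) simp_all
qed

text \<open>For \<open>f : A \<rightarrow> B\<close>, a morphism \<open>g\<close> on \<open>B\<close> with \<open>g \<cdot> f\<close> negligible is the same as one that extends
  to the pushout \<open>M\<close> of \<open>B\<close> and \<open>W'\<close> over \<open>A\<close>, where \<open>A \<rightarrowtail> W' \<twoheadrightarrow> S'\<close>. The object \<open>M\<close> stays in \<open>\<B>\<^sup>-\<close>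
  but may leave \<open>\<B>\<^sup>+\<close>; its reflection accounts for the same morphisms into the heart modulo
  negligible ones.\<close>

lemma cokernel_modulo_W:
  assumes f: "f \<in> Arr C" "Dom C f \<in> H" "Cod C f \<in> H"
  obtains c where "c \<in> Arr C" "Dom C c = Cod C f" "Cod C c \<in> H" "negligible (c \<cdot> f)"
    "\<And>g. \<lbrakk>g \<in> Arr C; Dom C g = Cod C f; Cod C g \<in> H; negligible (g \<cdot> f)\<rbrakk>
      \<Longrightarrow> \<exists>u\<in>Arr C. Dom C u = Cod C c \<and> Cod C u = Cod C g \<and> u \<cdot> c = g"
    "\<And>u. \<lbrakk>u \<in> Arr C; Dom C u = Cod C c; Cod C u \<in> H; negligible (u \<cdot> c)\<rbrakk> \<Longrightarrow> negligible u"
proof -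
  obtain i s where is': "(i, s) \<in> E" "Dom C i = Dom C f" "Cod C i \<in> W" "Cod C s \<in> S"
    using f(2) by (auto elim: BminusE)
  note iD = sesD(1-3)[OF is'(1)]
  obtain m w where po: "pushout C i f m w"
    by (rule ex_pushout[OF is'(1), of f]) (use f is' in simp_all)
  note poD = pushoutD[OF po]
  obtain q where q: "(m, q) \<in> E" "Cod C q = Cod C s" by (rule ses_pushout[OF is'(1) po])
  obtain c t where ct: "(c, t) \<in> E" "Dom C c = Cod C m" "Cod C t \<in> S" "Cod C c \<in> Bp"
    and refl: "\<And>g. \<lbrakk>g \<in> Arr C; Dom C g = Cod C m; Cod C g \<in> Bp\<rbrakk>
      \<Longrightarrow> \<exists>u\<in>Arr C. Dom C u = Cod C c \<and> Cod C u = Cod C g \<and> u \<cdot> c = g"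
    by (rule reflection[of "Cod C m"]) (use poD in auto)
  note cD = sesD(1)[OF ct(1)]
  have "Cod C m \<in> Bm" using Bm_extension[OF q(1)] poD f q is' by simp
  then have "Cod C c \<in> Bm" using Bm_extension[OF ct(1)] ct by simp
  then have cH: "Cod C c \<in> H" using ct by simp
  have cm: "c \<cdot> m \<in> Arr C" "Dom C (c \<cdot> m) = Cod C f" "Cod C (c \<cdot> m) = Cod C c"
    using cD poD ct by simp_all
  have "(c \<cdot> m) \<cdot> f = (c \<cdot> w) \<cdot> i" using cD poD ct by (simp add: assoc)
  moreover have "negligible ((c \<cdot> w) \<cdot> i)" using cD poD ct is' by (intro negligibleI) simp_all
  ultimately have cmf: "negligible ((c \<cdot> m) \<cdot> f)" by simp
  show ?thesis
  proof (rule that[OF cm(1,2) _ cmf])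
    show "Cod C (c \<cdot> m) \<in> H" using cm cH by simp
  next
    fix g assume g: "g \<in> Arr C" "Dom C g = Cod C f" "Cod C g \<in> H" "negligible (g \<cdot> f)"
    have gf: "Dom C (g \<cdot> f) = Dom C f" "Cod C (g \<cdot> f) = Cod C g" using f g by simp_all
    obtain k where k: "k \<in> Arr C" "Dom C k = Cod C i" "Cod C k = Cod C (g \<cdot> f)" "k \<cdot> i = g \<cdot> f"
      by (rule negligible_extend[OF is'(1,4) g(4)]) (use is' gf in simp_all)
    obtain h where h: "h \<in> Arr C" "Dom C h = Cod C w" "Cod C h = Cod C k" "h \<cdot> m = g"
      by (rule pushoutE[OF po, of g k]) (use g k gf in simp_all)
    obtain u where u: "u \<in> Arr C" "Dom C u = Cod C c" "Cod C u = Cod C h" "u \<cdot> c = h"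
      using refl[of h] h poD k gf g by auto
    have "u \<cdot> (c \<cdot> m) = g" using u h cD poD ct by (simp flip: assoc)
    then show "\<exists>u\<in>Arr C. Dom C u = Cod C (c \<cdot> m) \<and> Cod C u = Cod C g \<and> u \<cdot> (c \<cdot> m) = g"
      using u h k gf cm by (intro bexI[of _ u]) simp_all
  next
    fix u assume u: "u \<in> Arr C" "Dom C u = Cod C (c \<cdot> m)" "Cod C u \<in> H" "negligible (u \<cdot> (c \<cdot> m))"
    have uc: "u \<cdot> c \<in> Arr C" "Dom C (u \<cdot> c) = Cod C m" "Cod C (u \<cdot> c) = Cod C u"
      "Dom C u = Cod C c"
      using u cm cD ct by simp_all
    \<comment> \<open>both \<open>m\<close> and \<open>c\<close> have cokernels in \<open>S\<close>, so negligibility descends along each\<close>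
    have "negligible ((u \<cdot> c) \<cdot> m)" using u uc(4) cD poD ct by (simp add: assoc)
    with uc u(3) is' q have "negligible (u \<cdot> c)"
      by - (rule negligible_if_comp_negligible[OF q(1)], simp_all)
    with uc u ct show "negligible u"
      by - (rule negligible_if_comp_negligible[OF ct(1)], simp_all)
  qed
qed

end

section \<open>The heart\<close>

context twin_cotorsion
begin

lemma W_sub_Bm: "W \<subseteq> Bm"
proof
  fix X assume X: "X \<in> W"
  then have Xo: "X \<in> Obj C" using UV.U_obj by auto
  obtain s where s: "(Idn C X, s) \<in> E" "zero_object C (Cod C s)" by (rule ses_id[OF Xo])
  have "Dom C (Idn C X) \<in> Bm"
    by (rule BminusI[OF s(1)]) (use sesD(1-3)[OF s(1)] ST.U_zero[OF s(2)] X Xo in simp_all)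
  then show "X \<in> Bm" using Xo by simp
qed

lemma Bm_biproduct:
  assumes "biproduct C X Y Z i j p q" "X \<in> Bm" "Y \<in> Bm"
  shows "Z \<in> Bm"
proof (rule Bminus_biproduct[OF W_biproduct _ assms(2,3,1)])
  show "\<exists>Z\<in>S. \<exists>i j p q. biproduct C X Y Z i j p q" if XY: "X \<in> S" "Y \<in> S" for X Y
  proof -
    obtain Z i j p q where Z: "biproduct C X Y Z i j p q"
      using ex_biproduct[of X Y] XY ST.U_obj by blast
    then show ?thesis using ST.U_biproduct[OF Z XY] by blast
  qed
qed

lemma W_sub_H: "W \<subseteq> H"
proof -
  interpret op: twin_cotorsion "op_cat C" "E\<inverse>" V U T S by (rule twin_cotorsion_op)
  have "W \<subseteq> Bp" using op.W_sub_Bm by (simp add: Bminus_op Int_commute)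
  then show ?thesis using W_sub_Bm by blast
qed

lemma H_biproduct:
  assumes "biproduct C X Y Z i j p q" "X \<in> H" "Y \<in> H"
  shows "Z \<in> H"
proof -
  interpret op: twin_cotorsion "op_cat C" "E\<inverse>" V U T S by (rule twin_cotorsion_op)
  have "Z \<in> Bp" using op.Bm_biproduct[of X Y Z p q i j] assms by (simp add: Bminus_op Int_commute)
  then show ?thesis using Bm_biproduct[OF assms(1)] assms by blast
qed

lemma H_obj: "H \<subseteq> Obj C"
  by (auto simp: Bplus_def)

lemma additive_quotient_H: "additive_quotient (full_sub C H) W"
proof (intro additive_quotient.intro additive_quotient_axioms.intro)
  show "additive_category (full_sub C H)"
    by (rule additive_full_sub[OF H_obj])
      (use W_sub_H ST.V_zero UV.U_zero H_biproduct in blast)+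
  show "W \<subseteq> Obj (full_sub C H)" using W_sub_H by simp
  show "W \<noteq> {}" by (rule W_nonempty)
  show "\<exists>Z\<in>W. \<exists>i j p q. biproduct (full_sub C H) X Y Z i j p q" if XY: "X \<in> W" "Y \<in> W" for X Y
  proof -
    obtain Z i j p q where Z: "Z \<in> W" "biproduct C X Y Z i j p q" using W_biproduct[OF XY] by blast
    then have "biproduct (full_sub C H) X Y Z i j p q"
      using biproduct_full_sub[OF H_obj, of X Y Z] W_sub_H XY by blast
    then show ?thesis using Z(1) by blast
  qed
qed

lemma heart_eq: "heart C E S T U V = quotient_cat (full_sub C H) W"
  by (simp add: heart_def Let_def)

lemma heart_additive: "additive_category (heart C E S T U V)"
  unfolding heart_eq by (rule additive_quotient.quotient_additive[OF additive_quotient_H])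

lemma heart_cokernel:
  assumes "F \<in> Arr (heart C E S T U V)"
  shows "\<exists>c. is_cokernel (heart C E S T U V) c F"
proof -
  interpret H: additive_quotient "full_sub C H" W by (rule additive_quotient_H)
  obtain f where F: "F = H.cls f" and f: "f \<in> Arr C" "Dom C f \<in> H" "Cod C f \<in> H"
    using assms unfolding heart_eq H.Q_simps by auto
  obtain c where c: "c \<in> Arr C" "Dom C c = Cod C f" "Cod C c \<in> H" "negligible (c \<cdot> f)"
    and factor: "\<And>g. \<lbrakk>g \<in> Arr C; Dom C g = Cod C f; Cod C g \<in> H; negligible (g \<cdot> f)\<rbrakk>
      \<Longrightarrow> \<exists>u\<in>Arr C. Dom C u = Cod C c \<and> Cod C u = Cod C g \<and> u \<cdot> c = g"
    and unique: "\<And>u. \<lbrakk>u \<in> Arr C; Dom C u = Cod C c; Cod C u \<in> H; negligible (u \<cdot> c)\<rbrakk> \<Longrightarrow> negligible u"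
    by (rule cokernel_modulo_W[OF f]) blast
  have negl: "H.negligible h \<longleftrightarrow> negligible h" if "Dom C h \<in> H" "Cod C h \<in> H" for h
    using factors_through_full_sub[OF W_sub_H that] .
  have "is_cokernel H.Q (H.cls c) (H.cls f)"
  proof (rule H.quotient_cokernel)
    show "f \<in> Arr (full_sub C H)" "c \<in> Arr (full_sub C H)"
      "Dom (full_sub C H) c = Cod (full_sub C H) f" using f c by simp_all
    show "H.negligible (c \<cdot>\<^bsub>full_sub C H\<^esub> f)" using c f negl[of "c \<cdot> f"] by simp
  next
    fix g assume g: "g \<in> Arr (full_sub C H)" "Dom (full_sub C H) g = Cod (full_sub C H) f"
      "H.negligible (g \<cdot>\<^bsub>full_sub C H\<^esub> f)"
    then have "\<exists>u\<in>Arr C. Dom C u = Cod C c \<and> Cod C u = Cod C g \<and> u \<cdot> c = g"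
      using f negl[of "g \<cdot> f"] by (intro factor) simp_all
    then show "\<exists>u\<in>Hom (full_sub C H) (Cod (full_sub C H) c) (Cod (full_sub C H) g).
      u \<cdot>\<^bsub>full_sub C H\<^esub> c = g" using g c by (auto simp: in_Hom)
  next
    fix u assume "u \<in> Arr (full_sub C H)" "Dom (full_sub C H) u = Cod (full_sub C H) c"
      "H.negligible (u \<cdot>\<^bsub>full_sub C H\<^esub> c)"
    then show "H.negligible u" using c f negl[of "u \<cdot> c"] negl[of u] unique[of u] by simp
  qed
  then show ?thesis unfolding heart_eq F by blast
qed

lemma heart_op: "heart (op_cat C) (E\<inverse>) V U T S = op_cat (heart C E S T U V)"
  by (simp add: heart_def Let_def Bplus_op Bminus_op full_sub_op quotient_cat_op Int_commute)

theorem heart_preabelian: "preabelian_category (heart C E S T U V)"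
proof (intro preabelian_category.intro heart_additive preabelian_category_axioms.intro heart_cokernel)
  interpret op: twin_cotorsion "op_cat C" "E\<inverse>" V U T S by (rule twin_cotorsion_op)
  fix f assume "f \<in> Arr (heart C E S T U V)"
  then show "\<exists>k. is_kernel (heart C E S T U V) k f"
    using op.heart_cokernel[of f] by (simp add: heart_op)
qed

end

theorem theorem3p10:
  fixes C :: "('o, 'm) cat" and E :: "('m \<times> 'm) set" and S T U V :: "'o set"
  assumes "exact_category C E"
    and "krull_schmidt C"
    and "enough_projectives C E"
    and "enough_injectives C E"
    and "twin_cotorsion_pair C E S T U V"
  shows "preabelian_category (heart C E S T U V)"
proof -
  have "twin_cotorsion C E S T U V"
    using assms(1,5) by (rule exact_category.twin_cotorsion_if_pair)
  then show ?thesis by (rule twin_cotorsion.heart_preabelian)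
qed

end
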